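(* Let $G$ be an (acyclic) ADT network with set of sources $\mathcal S$ and set of destinations $\mathcal T$, and let $\mathcal C=\{(S_i,T_j,\mathcal X(S_i)) : S_i\in\mathcal S,\ T_j\in\mathcal T\}$. Then $(G,\mathcal C)$ is solvable if and only if the Min-cut Max-flow bound is satisfied for any cut between the source nodes $\mathcal S$ and a destination $T_j$, for all $T_j\in\mathcal T$.
   Context: Network. An ADT network is a directed graph $G=(\mathcal V,\mathcal E)$ with node set $\mathcal V$ and edge set $\mathcal E$; each node $V$ has a set $I(V)$ of input ports and a set $O(V)$ of output ports. An edge is a pair $(e_1,e_2)$ going from an output port $e_1\in O(V_1)$ to an input port $e_2\in I(V_2)$, $V_1,V_2\in\mathcal V$. All edges have unit capacity (one symbol of $\mathbb F_q$ per time unit). $G$ has no directed cycles. $\mathcal S,\mathcal T\subseteq\mathcal V$. Linear transmission over a finite field $\mathbb F_q$. Each source $S\in\mathcal S$ has independent random processes $\mathcal X(S)=[X(S,1),\dots,X(S,\mu(S))]$, $\mu(S)=|\mathcal X(S)|\le|O(S)|$. $Y(e)$ denotes the process at port $e$. For $e\in O(V)$: $Y(e)=\sum_{e'\in I(V)}\beta_{(e',e)}Y(e')$, plus $\sum_i\alpha_{(i,e)}X(V,i)$ if $V\in\mathcal S$. All edges leaving an output port carry the same symbol (broadcast), and at an input port $e'$ the incoming symbols are added: $Y(e')=\sum_{(e,e')\in\mathcal E}Y(e)$. A destination $T$ forms $\mathcal Z(T)=[Z(T,1),\dots,Z(T,\nu(T))]$ with $Z(T,k)=\sum_{e'\in I(T)}\epsilon_{(e',(T,k))}Y(e')$.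 A connection $(S_i,T_j,\mathcal X(S_i))$ is the demand that $T_j$ reproduce $\mathcal X(S_i)$ in $\mathcal Z(T_j)$; in $\mathcal C$ every destination demands all processes of every source. $(G,\mathcal C)$ is solvable if the coefficients $\alpha,\beta,\epsilon$ can be chosen from $\mathbb F_q$ so that all connections in $\mathcal C$ are established simultaneously; the field is not restricted to $\mathbb F_2$ and may be taken sufficiently large. Cuts. A cut between $\mathcal S$ and $T_j$ is a partition of $\mathcal V$ into $\Omega$ and $\Omega^c$ with $\mathcal S\subseteq\Omega$ and $T_j\in\Omega^c$. Its value is $\operatorname{rank}(G_\Omega)$, where $G_\Omega$ is the $0$-$1$ incidence matrix, with entries regarded in $\mathbb F_q$, of the bipartite graph of edges from output ports of nodes in $\Omega$ to input ports of nodes in $\Omega^c$. The Min-cut Max-flow bound for the cut is that its value is at least the total rate demanded by $T_j$: $\operatorname{rank}(G_\Omega)\ge\sum_{S_i\in\mathcal S}|\mathcal X(S_i)|$.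
   Formalization: The bound is imposed on cuts between every subset of the sources and T_j (with that subset's total rate), not only cuts containing all of S, since the claim is false otherwise for several sources; sources and destinations are assumed disjoint. *)

theory Defs
  imports "HOL-Analysis.Analysis" "HOL-Algebra.Algebraic_Closure_Type"
begin

text \<open>
  The index type of ports is finite, so that incidence matrices are matrices in the sense of
  \<^theory>\<open>HOL-Analysis.Finite_Cartesian_Product\<close>; not every element of the type has to
  occur as a port of some node.
\<close>

record ('v, 'p) adt_graph =
  nodes :: "'v set"
  edges :: "('p \<times> 'p) set"
  inp :: "'v \<Rightarrow> 'p set"
  outp :: "'v \<Rightarrow> 'p set"

definition node_rel :: "('v, 'p) adt_graph \<Rightarrow> ('v \<times> 'v) set" where
  "node_rel G = {(V, W). V \<in> nodes G \<and> W \<in> nodes G \<and>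
      (\<exists>e\<in>outp G V. \<exists>e'\<in>inp G W. (e, e') \<in> edges G)}"

locale adt_network =
  fixes G :: "('v, 'p::finite) adt_graph"
  assumes finite_nodes: "finite (nodes G)"
    and ports_disjoint: "\<lbrakk>V \<in> nodes G; W \<in> nodes G; V \<noteq> W\<rbrakk> \<Longrightarrow>
          (inp G V \<union> outp G V) \<inter> (inp G W \<union> outp G W) = {}"
    and inp_outp_disjoint: "V \<in> nodes G \<Longrightarrow> inp G V \<inter> outp G V = {}"
    and edges_subset: "edges G \<subseteq> (\<Union>V\<in>nodes G. outp G V) \<times> (\<Union>V\<in>nodes G. inp G V)"
    and acyclic: "acyclic (node_rel G)"


subsection \<open>Linear transmission\<close>

text \<open>
  The processes of a source \<open>S\<close> are indexed by \<open>i < \<mu> S\<close>. As the code is linear, memoryless and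
  delay-free, it acts in the same way in every time unit; so \<open>x S i\<close> stands for the symbol of
  the \<open>i\<close>-th process of \<open>S\<close> in one time unit, and \<open>Y e\<close> for the symbol at the port \<open>e\<close>.
\<close>

definition transmission ::
  "('v, 'p) adt_graph \<Rightarrow> 'v set \<Rightarrow> ('v \<Rightarrow> nat) \<Rightarrow> (nat \<Rightarrow> 'p \<Rightarrow> 'f::field) \<Rightarrow> ('p \<Rightarrow> 'p \<Rightarrow> 'f) \<Rightarrow>
   ('v \<Rightarrow> nat \<Rightarrow> 'f) \<Rightarrow> ('p \<Rightarrow> 'f) \<Rightarrow> bool" where
  "transmission G \<S> \<mu> \<alpha> \<beta> x Y \<longleftrightarrow>
     (\<forall>V\<in>nodes G. \<forall>e\<in>outp G V.
        Y e = (\<Sum>e'\<in>inp G V. \<beta> e' e * Y e') + (if V \<in> \<S> then \<Sum>i<\<mu> V. \<alpha> i e * x V i else 0)) \<and>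
     (\<forall>V\<in>nodes G. \<forall>e'\<in>inp G V. Y e' = (\<Sum>e | (e, e') \<in> edges G. Y e))"

definition destination_output ::
  "('v, 'p) adt_graph \<Rightarrow> ('p \<Rightarrow> 'v \<Rightarrow> nat \<Rightarrow> 'f::field) \<Rightarrow> ('p \<Rightarrow> 'f) \<Rightarrow> 'v \<Rightarrow> nat \<Rightarrow> 'f" where
  "destination_output G \<epsilon> Y T k = (\<Sum>e'\<in>inp G T. \<epsilon> e' T k * Y e')"

text \<open>
  A connection \<open>(S, T, D)\<close> is the demand that \<open>T\<close> reproduces the processes of \<open>S\<close> with index in
  \<open>D\<close>. Independence of the source processes enters as the quantification over all values of all
  source symbols. The number \<open>\<nu> T\<close> of outputs formed by \<open>T\<close> is chosen with the code. In an
  acyclic network \<open>Y x\<close> is determined on all ports by \<open>x\<close> and the coefficients.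
\<close>

type_synonym 'v connection = "'v \<times> 'v \<times> nat set"

definition solvable_over ::
  "'f::field set \<Rightarrow> ('v, 'p) adt_graph \<Rightarrow> 'v set \<Rightarrow> ('v \<Rightarrow> nat) \<Rightarrow> 'v connection set \<Rightarrow> bool" where
  "solvable_over K G \<S> \<mu> C \<longleftrightarrow>
     (\<exists>\<alpha> \<beta> \<epsilon> \<nu> Y.
        (\<forall>i e. \<alpha> i e \<in> K) \<and> (\<forall>e' e. \<beta> e' e \<in> K) \<and> (\<forall>e' T k. \<epsilon> e' T k \<in> K) \<and>
        (\<forall>x. (\<forall>S i. x S i \<in> K) \<longrightarrow> transmission G \<S> \<mu> \<alpha> \<beta> x (Y x)) \<and>
        (\<forall>(S, T, D)\<in>C. \<forall>i\<in>D. \<exists>k<\<nu> T. \<forall>x. (\<forall>S i. x S i \<in> K) \<longrightarrow>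
           destination_output G \<epsilon> (Y x) T k = x S i))"

text \<open>
  The field may be taken sufficiently large: the coefficients and symbols live in some finite
  extension of the finite field \<open>'q\<close>, that is, in some finite subfield of the algebraic closure of
  \<open>'q\<close> that contains \<open>'q\<close>.
\<close>

definition solvable ::
  "'q::{field,finite} itself \<Rightarrow> ('v, 'p) adt_graph \<Rightarrow> 'v set \<Rightarrow> ('v \<Rightarrow> nat) \<Rightarrow>
   'v connection set \<Rightarrow> bool" where
  "solvable q G \<S> \<mu> C \<longleftrightarrow>
     (\<exists>K :: 'q alg_closure set. finite K \<and> subfield K ring_of_type_algebra \<and>
        range to_ac \<subseteq> K \<and> solvable_over K G \<S> \<mu> C)"

definition multicast_connections :: "'v set \<Rightarrow> 'v set \<Rightarrow> ('v \<Rightarrow> nat) \<Rightarrow> 'v connection set" where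
  "multicast_connections \<S> \<T> \<mu> = {(S, T, {..<\<mu> S}) | S T. S \<in> \<S> \<and> T \<in> \<T>}"


subsection \<open>Cuts\<close>

text \<open>A cut is represented by \<open>\<Omega>\<close>; its other side is the complement of \<open>\<Omega>\<close> in the node set.\<close>

definition is_cut :: "('v, 'p) adt_graph \<Rightarrow> 'v set \<Rightarrow> 'v \<Rightarrow> 'v set \<Rightarrow> bool" where
  "is_cut G \<S> T \<Omega> \<longleftrightarrow> \<Omega> \<subseteq> nodes G \<and> \<S> \<subseteq> \<Omega> \<and> T \<in> nodes G - \<Omega>"

text \<open>
  Rows belong to input ports and columns to output ports; rows and columns of ports that do not
  take part in the cut are zero, which does not affect the rank.
\<close>

definition cut_matrix :: "('v, 'p::finite) adt_graph \<Rightarrow> 'v set \<Rightarrow> 'q::field ^ 'p ^ 'p" where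
  "cut_matrix G \<Omega> = (\<chi> e' e.
     if (e, e') \<in> edges G \<and> e \<in> (\<Union>V\<in>\<Omega>. outp G V) \<and> e' \<in> (\<Union>V\<in>nodes G - \<Omega>. inp G V)
     then 1 else 0)"

definition cut_value :: "'q::field itself \<Rightarrow> ('v, 'p::finite) adt_graph \<Rightarrow> 'v set \<Rightarrow> nat" where
  "cut_value q G \<Omega> = rank (cut_matrix G \<Omega> :: 'q ^ 'p ^ 'p)"

text \<open>
  The bound is stated for an arbitrary set \<open>\<S>\<close> of source nodes. In a network with several sources
  it has to be imposed on the cuts between every subset of the sources and a destination (the
  cuts below a super-source that feeds each source \<open>S\<close> with \<open>\<mu> S\<close> unit edges). Imposing it only on
  cuts that contain all sources is not sufficient for solvability: too small a capacity from one
  source can be hidden in the rank by excess capacity from another one.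
\<close>

definition mincut_maxflow_bound ::
  "'q::field itself \<Rightarrow> ('v, 'p::finite) adt_graph \<Rightarrow> 'v set \<Rightarrow> ('v \<Rightarrow> nat) \<Rightarrow> 'v set \<Rightarrow> bool" where
  "mincut_maxflow_bound q G \<S> \<mu> \<Omega> \<longleftrightarrow> cut_value q G \<Omega> \<ge> (\<Sum>S\<in>\<S>. \<mu> S)"

end

theory Submission
  imports Defs "HOL-Number_Theory.Residues"
begin

text \<open>
  Necessity: if the sources outside a cut \<open>\<Omega>\<close> send zero, everything beyond \<open>\<Omega>\<close> is determined by the
  flow through the cut matrix, which takes at most \<open>|K| ^ rank\<close> values, whereas the destination
  recovers \<open>|K| ^ (\<Sum>S\<in>\<S>'. \<mu> S)\<close> different inputs.

  Sufficiency is a union bound over all codes with coefficients in a finite field \<open>K\<close>. Fix an input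
  and let \<open>\<Omega>\<close> be the set of nodes that receive something nonzero. The fraction of codes producing
  exactly this \<open>\<Omega>\<close> is at most \<open>|K| ^ (- rank G\<^sub>\<Omega>)\<close>: every output port of \<open>\<Omega>\<close> carries a uniformly
  distributed symbol, and these symbols have to lie in the kernel of the cut matrix. If \<open>\<Omega>\<close> misses a
  destination, the bound gives \<open>rank G\<^sub>\<Omega> \<ge> m\<close>, where \<open>m\<close> is the total rate of the sources in \<open>\<Omega>\<close>. It
  suffices to consider inputs in which a chosen coordinate is 1, and of these only \<open>|K| ^ (m - 1)\<close>
  vanish outside \<open>\<Omega>\<close>. So each \<open>\<Omega>\<close> and each coordinate spoil at most a fraction \<open>1 / |K|\<close> of the
  codes, and for large \<open>K\<close> some code makes the map from the inputs to the symbols received by each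
  destination injective.
\<close>

unbundle no fps_syntax

subsection \<open>Linear algebra over a subfield given as a set\<close>

text \<open>The finite extension that carries a code is a set inside the algebraic closure and not a
  type, so linear algebra over it works with closure conditions.\<close>

locale subfield_of_type =
  fixes K :: "'f::field set"
  assumes zero_closed [simp, intro]: "0 \<in> K"
    and one_closed [simp, intro]: "1 \<in> K"
    and add_closed [intro!]: "\<lbrakk>a \<in> K; b \<in> K\<rbrakk> \<Longrightarrow> a + b \<in> K"
    and mult_closed [intro!]: "\<lbrakk>a \<in> K; b \<in> K\<rbrakk> \<Longrightarrow> a * b \<in> K"
    and uminus_closed [intro!]: "a \<in> K \<Longrightarrow> - a \<in> K"
    and inverse_closed [intro!]: "a \<in> K \<Longrightarrow> inverse a \<in> K"
begin

lemma diff_closed [intro!]: "\<lbrakk>a \<in> K; b \<in> K\<rbrakk> \<Longrightarrow> a - b \<in> K"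
  using add_closed[OF _ uminus_closed, of a b] by simp

lemma divide_closed [intro!]: "\<lbrakk>a \<in> K; b \<in> K\<rbrakk> \<Longrightarrow> a / b \<in> K"
  by (auto simp: divide_inverse)

lemma sum_closed [intro!]: "(\<And>i. i \<in> A \<Longrightarrow> f i \<in> K) \<Longrightarrow> sum f A \<in> K"
  by (induction A rule: infinite_finite_induct) auto

text \<open>The induction adds one vector \<open>a k\<close>: \<open>b\<close> is \<open>a k\<close>
  minus its components along the earlier vectors, and a coordinate where \<open>b\<close> is nonzero
  yields a functional \<open>\<psi>\<close> that kills the earlier vectors and is 1 on
  \<open>a k\<close>. Used with \<open>K = UNIV\<close> for the rows of a matrix, and with the
  finite field for decoding at a destination.\<close>

lemma dual_functionals:
  assumes "finite J" "finite E"
    and "\<And>j e. \<lbrakk>j \<in> J; e \<in> E\<rbrakk> \<Longrightarrow> a j e \<in> K"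
    and "\<And>t. \<lbrakk>\<And>j. t j \<in> K; \<And>e. e \<in> E \<Longrightarrow> (\<Sum>j\<in>J. t j * a j e) = 0\<rbrakk> \<Longrightarrow> \<forall>j\<in>J. t j = 0"
  shows "\<exists>\<phi>. (\<forall>j e. \<phi> j e \<in> K) \<and>
     (\<forall>i\<in>J. \<forall>j\<in>J. (\<Sum>e\<in>E. \<phi> i e * a j e) = (if i = j then 1 else 0))"
  using assms(1,3,4)
proof (induction J)
  case empty
  show ?case by (intro exI[of _ "\<lambda>_ _. 0"]) auto
next
  case (insert k J)
  have indep: "\<forall>j\<in>J. t j = 0" if t: "\<And>j. t j \<in> K" "\<And>e. e \<in> E \<Longrightarrow> (\<Sum>j\<in>J. t j * a j e) = 0" for t
  proof -
    have "(\<Sum>j\<in>J. (t(k := 0)) j * a j e) = (\<Sum>j\<in>J. t j * a j e)" for e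
      using insert.hyps by (intro sum.cong) auto
    then have "\<forall>j\<in>insert k J. (t(k := 0)) j = 0"
      using insert.hyps t by (intro insert.prems(2)) auto
    then show ?thesis using insert.hyps by (metis fun_upd_other insertCI)
  qed
  have "\<exists>\<phi>. (\<forall>j e. \<phi> j e \<in> K) \<and>
     (\<forall>i\<in>J. \<forall>j\<in>J. (\<Sum>e\<in>E. \<phi> i e * a j e) = (if i = j then 1 else 0))"
    by (rule insert.IH[OF insert.prems(1) indep]) auto
  then obtain \<phi> where \<phi>: "\<And>j e. \<phi> j e \<in> K"
    "\<And>i j. \<lbrakk>i \<in> J; j \<in> J\<rbrakk> \<Longrightarrow> (\<Sum>e\<in>E. \<phi> i e * a j e) = (if i = j then 1 else 0)"
    by blast
  define c where "c i = (\<Sum>e\<in>E. \<phi> i e * a k e)" for i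
  define b where "b e = a k e - (\<Sum>i\<in>J. c i * a i e)" for e
  have cK: "c i \<in> K" for i
    unfolding c_def using \<phi>(1) insert.prems(1) by auto
  have "\<exists>e0\<in>E. b e0 \<noteq> 0"
  proof (rule ccontr)
    assume "\<not> ?thesis"
    then have b0: "b e = 0" if "e \<in> E" for e using that by auto
    \<comment> \<open>If \<open>b\<close> vanished on \<open>E\<close>, these would be the
      coefficients of a linear relation with entry 1 at \<open>k\<close>.\<close>
    define t where "t j = (if j = k then 1 else - c j)" for j
    have "(\<Sum>j\<in>insert k J. t j * a j e) = b e" for e
    proof -
      have "(\<Sum>j\<in>J. t j * a j e) = (\<Sum>j\<in>J. - (c j * a j e))"
        using insert.hyps by (intro sum.cong) (auto simp: t_def)
      then show ?thesis
        using insert.hyps by (simp add: t_def b_def sum_negf)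
    qed
    then have "\<forall>j\<in>insert k J. t j = 0"
      using cK b0 by (intro insert.prems(2)) (auto simp: t_def)
    then show False by (auto simp: t_def)
  qed
  then obtain e0 where e0: "e0 \<in> E" "b e0 \<noteq> 0" by blast
  \<comment> \<open>Subtract from a vector its projection to the span of the \<open>a i\<close> with \<open>i \<in> J\<close>, then read off
    coordinate \<open>e0\<close>.\<close>
  define \<psi> where "\<psi> e = (if e \<in> E then ((if e = e0 then 1 else 0) - (\<Sum>i\<in>J. \<phi> i e * a i e0)) / b e0 else 0)" for e
  have bK: "b e0 \<in> K"
    unfolding b_def using e0(1) insert.prems(1) cK by auto
  have \<psi>K: "\<psi> e \<in> K" for e
    unfolding \<psi>_def using bK e0(1) insert.prems(1) \<phi>(1) by auto
  have \<psi>_apply: "(\<Sum>e\<in>E. \<psi> e * v e) = (v e0 - (\<Sum>i\<in>J. (\<Sum>e\<in>E. \<phi> i e * v e) * a i e0)) / b e0" for v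
  proof -
    have "(\<Sum>e\<in>E. \<psi> e * v e) =
        (\<Sum>e\<in>E. ((if e = e0 then v e0 else 0) - (\<Sum>i\<in>J. \<phi> i e * v e * a i e0)) / b e0)"
      by (intro sum.cong) (auto simp: \<psi>_def algebra_simps sum_distrib_left)
    also have "\<dots> = (v e0 - (\<Sum>e\<in>E. \<Sum>i\<in>J. \<phi> i e * v e * a i e0)) / b e0"
      using e0(1) assms(2) by (simp add: sum_subtractf flip: sum_divide_distrib)
    also have "(\<Sum>e\<in>E. \<Sum>i\<in>J. \<phi> i e * v e * a i e0) = (\<Sum>i\<in>J. (\<Sum>e\<in>E. \<phi> i e * v e) * a i e0)"
      by (subst sum.swap) (simp add: sum_distrib_right)
    finally show ?thesis .
  qed
  have \<psi>_k: "(\<Sum>e\<in>E. \<psi> e * a k e) = 1"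
    using e0 unfolding \<psi>_apply by (simp add: b_def c_def)
  have \<psi>_J: "(\<Sum>e\<in>E. \<psi> e * a j e) = 0" if "j \<in> J" for j
  proof -
    have "(\<Sum>i\<in>J. (\<Sum>e\<in>E. \<phi> i e * a j e) * a i e0) = (\<Sum>i\<in>J. if i = j then a j e0 else 0)"
      using that \<phi>(2) by (intro sum.cong) auto
    then show ?thesis using that insert.hyps unfolding \<psi>_apply by simp
  qed
  \<comment> \<open>The old functional \<open>\<phi> i\<close> takes the value \<open>c i\<close> on
    \<open>a k\<close>. Subtracting \<open>c i\<close> times \<open>\<psi>\<close> cancels it and
    changes nothing on the earlier vectors, where \<open>\<psi>\<close> is 0.\<close>
  define \<phi>' where "\<phi>' i e = (if i = k then \<psi> e else \<phi> i e - c i * \<psi> e)" for i e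
  have *: "(\<Sum>e\<in>E. \<phi>' i e * a j e) = (\<Sum>e\<in>E. \<phi> i e * a j e) - c i * (\<Sum>e\<in>E. \<psi> e * a j e)"
    if "i \<noteq> k" for i j
    using that by (simp add: \<phi>'_def algebra_simps sum_subtractf sum_distrib_left)
  have **: "(\<Sum>e\<in>E. \<phi>' k e * a j e) = (\<Sum>e\<in>E. \<psi> e * a j e)" for j
    by (simp add: \<phi>'_def)
  show ?case
  proof (intro exI[of _ \<phi>'] conjI allI ballI)
    show "\<phi>' j e \<in> K" for j e
      unfolding \<phi>'_def using \<phi>(1) \<psi>K cK by auto
    show "(\<Sum>e\<in>E. \<phi>' i e * a j e) = (if i = j then 1 else 0)" if "i \<in> insert k J" "j \<in> insert k J" for i j
    proof (cases "i = k")
      case True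
      with that insert.hyps show ?thesis by (auto simp: ** \<psi>_k \<psi>_J)
    next
      case False
      have "(\<Sum>e\<in>E. \<phi> i e * a k e) = c i" by (simp add: c_def)
      with False that insert.hyps show ?thesis
        by (auto simp: * \<psi>_k \<psi>_J \<phi>(2))
    qed
  qed
qed

end

section \<open>Subfields as sets versus subfields of the ring structure of a type\<close>

lemma subfield_of_typeI:
  assumes "subfield K (ring_of_type_algebra :: 'f::field ring)"
  shows "subfield_of_type K"
proof -
  let ?R = "ring_of_type_algebra :: 'f ring"
  interpret R: ring ?R by (rule ring_from_type_algebra)
  interpret F: field ?R by (rule field_from_type_algebra)
  have sr: "subring K ?R" using subfieldE(1)[OF assms] .
  note E = subringE[OF sr]
  have R_simps: "carrier ?R = UNIV" "mult ?R = (*)" "add ?R = (+)" "one ?R = 1" "zero ?R = 0"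
    by (auto simp: ring_of_type_algebra_def fun_eq_iff)
  have neg: "a_inv ?R a = - a" for a
    using R.minus_equality[of "- a" a] by (simp add: R_simps)
  have inv: "inverse a \<in> K" if "a \<in> K" for a
  proof (cases "a = 0")
    case False
    then have a: "a \<in> K - {zero ?R}" using that by (simp add: R_simps)
    have "m_inv ?R a = inverse a"
      using R.subfield_m_inv(3)[OF assms a] by (simp add: R_simps inverse_unique mult.commute)
    then show ?thesis using R.subfield_m_inv(1)[OF assms a] by simp
  qed (use E(2) in \<open>simp add: R_simps\<close>)
  show ?thesis
  proof
    show "- a \<in> K" if "a \<in> K" for a
      using E(5)[OF that] by (simp only: neg)
  qed (use E(2,3,6,7)[unfolded R_simps] inv in blast)+
qed

lemma subfield_ring_of_typeI:
  assumes "subfield_of_type (K :: 'f::field set)"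
  shows "subfield K ring_of_type_algebra"
proof -
  let ?R = "ring_of_type_algebra :: 'f ring"
  interpret subfield_of_type K by fact
  interpret R: ring ?R by (rule ring_from_type_algebra)
  interpret F: field ?R by (rule field_from_type_algebra)
  have R_simps: "carrier ?R = UNIV" "mult ?R = (*)" "add ?R = (+)" "one ?R = 1" "zero ?R = 0"
    by (auto simp: ring_of_type_algebra_def fun_eq_iff)
  have neg: "a_inv ?R a = - a" for a
    using R.minus_equality[of "- a" a] by (simp add: R_simps)
  have inv: "m_inv ?R a = inverse a" if "a \<noteq> 0" for a
    using F.comm_inv_char[of a "inverse a"] that by (simp add: R_simps)
  show ?thesis
  proof (rule F.subfieldI')
    show "subring K ?R"
      by (rule R.subringI) (auto simp: R_simps neg)
  qed (auto simp: R_simps inv)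
qed

text \<open>A basis of the row space is chosen among the rows. Its independence is recorded by the
  dual family \<open>u\<close> and its spanning by the expansions \<open>d\<close>, because explicit
  identities can be mapped into a larger field, whereas \<open>rank\<close> refers to
  \<open>'q\<close> alone.\<close>

lemma rank_row_basis:
  fixes M :: "'q::field ^ 'n ^ 'm"
  obtains B u d where "card B = rank M"
    and "\<And>i j. \<lbrakk>i \<in> B; j \<in> B\<rbrakk> \<Longrightarrow> (\<Sum>e\<in>UNIV. u i e * M $ j $ e) = (if i = j then 1 else 0)"
    and "\<And>i e. M $ i $ e = (\<Sum>b\<in>B. d i b * M $ b $ e)"
proof -
  obtain R where R: "R \<subseteq> rows M" "vec.independent R" "rows M \<subseteq> vec.span R" "card R = vec.dim (rows M)"
    using vec.basis_exists[of "rows M"] by metis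
  have fR: "finite R" using R(2) vec.finiteI_independent by blast
  \<comment> \<open>A vector of \<open>R\<close> may occur as several rows; \<open>g\<close> selects
    one index for each, so that \<open>B\<close> has as many elements as \<open>R\<close>.\<close>
  have "\<forall>v\<in>R. \<exists>i. row i M = v" using R(1) by (auto simp: rows_def)
  then obtain g where g: "\<And>v. v \<in> R \<Longrightarrow> row (g v) M = v" by metis
  define B where "B = g ` R"
  have inj_g: "inj_on g R" by (rule inj_on_inverseI[of R "\<lambda>i. row i M"]) (rule g)
  have rowB: "bij_betw (\<lambda>i. row i M) B R"
    unfolding B_def bij_betw_def inj_on_def using g by (auto simp: image_iff)
  have row: "row i M $ e = M $ i $ e" for i e by (simp add: row_def)
  interpret F: subfield_of_type "UNIV :: 'q set" by standard auto
  have ex_u: "\<exists>u. (\<forall>j e. u j e \<in> (UNIV :: 'q set)) \<and>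
     (\<forall>i\<in>B. \<forall>j\<in>B. (\<Sum>e\<in>UNIV. u i e * M $ j $ e) = (if i = j then 1 else 0))"
  proof (rule F.dual_functionals)
    fix t :: "'m \<Rightarrow> 'q"
    assume t: "\<And>e. e \<in> UNIV \<Longrightarrow> (\<Sum>j\<in>B. t j * M $ j $ e) = 0"
    have "(\<Sum>v\<in>R. t (g v) *s v) = (\<Sum>j\<in>B. t j *s row j M)"
      unfolding B_def by (subst sum.reindex[OF inj_g]) (auto simp: g)
    also have "\<dots> = 0"
      using t by (simp add: vec_eq_iff row)
    finally have "\<forall>v\<in>R. t (g v) = 0"
      using R(2) fR vec.independentD[of R R "\<lambda>v. t (g v)"] by blast
    then show "\<forall>j\<in>B. t j = 0" by (auto simp: B_def)
  qed (auto simp: B_def fR)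
  have ex_d: "\<forall>i. \<exists>d. \<forall>e. M $ i $ e = (\<Sum>b\<in>B. d b * M $ b $ e)"
  proof
    fix i
    have "row i M \<in> vec.span R" using R(3) by (auto simp: rows_def)
    then obtain c where c: "row i M = (\<Sum>v\<in>R. c v *s v)"
      using vec.span_finite[OF fR] by auto
    have "M $ i $ e = (\<Sum>b\<in>B. c (row b M) * M $ b $ e)" for e
    proof -
      have "M $ i $ e = (\<Sum>v\<in>R. c v * v $ e)"
        using arg_cong[OF c, of "\<lambda>v. v $ e"] by (simp add: row)
      also have "\<dots> = (\<Sum>b\<in>B. c (row b M) * row b M $ e)"
        by (rule sum.reindex_bij_betw[OF rowB, symmetric])
      finally show ?thesis by (simp add: row)
    qed
    then show "\<exists>d. \<forall>e. M $ i $ e = (\<Sum>b\<in>B. d b * M $ b $ e)" by (intro exI) auto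
  qed
  have card_B: "card B = rank M"
    by (simp add: B_def card_image[OF inj_g] R(4) row_rank_def_gen)
  from ex_u obtain u where u:
    "\<forall>i\<in>B. \<forall>j\<in>B. (\<Sum>e\<in>UNIV. u i e * M $ j $ e) = (if i = j then 1 else 0)"
    by blast
  from choice[OF ex_d] obtain d where d: "\<forall>i e. M $ i $ e = (\<Sum>b\<in>B. d i b * M $ b $ e)" by blast
  show ?thesis by (rule that[OF card_B, of u d]) (use u d in blast)+
qed

subsection \<open>Large finite subfields of the algebraic closure\<close>

lemma finite_field_power_card_minus_1:
  fixes x :: "'q::{field,finite}"
  assumes "x \<noteq> 0"
  shows "x ^ (CARD('q) - 1) = 1"
proof -
  let ?U = "UNIV - {0 :: 'q}"
  have "bij_betw ((*) x) ?U ?U"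
    by (rule bij_betwI[of _ _ _ "(*) (inverse x)"]) (use assms in auto)
  then have "(\<Prod>y\<in>?U. x * y) = \<Prod>?U"
    by (rule prod.reindex_bij_betw)
  then have "x ^ card ?U * \<Prod>?U = 1 * \<Prod>?U"
    by (simp add: prod.distrib)
  moreover have "\<Prod>?U \<noteq> 0" by auto
  ultimately have "x ^ card ?U = 1" using mult_right_cancel by blast
  then show ?thesis by (simp add: card_Diff_singleton)
qed

text \<open>The derivative of X^N - X is -1 because N vanishes in the field. Hence no root is
  repeated, and over an algebraically closed field the polynomial splits into N distinct linear
  factors.\<close>

lemma card_roots_power_minus_id:
  fixes N :: nat
  assumes N: "N > 1" "of_nat N = (0 :: 'f::alg_closed_field)"
  shows "card {x :: 'f. x ^ N = x} = N" "finite {x :: 'f. x ^ N = x}"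
proof -
  define p :: "'f poly" where "p = Polynomial.monom 1 N - [:0, 1:]"
  have deg: "Polynomial.degree p = N"
    unfolding p_def diff_conv_add_uminus
    using N(1) by (subst degree_add_eq_left) (auto simp: degree_monom_eq)
  then have p0: "p \<noteq> 0" using N(1) by auto
  have poly_p: "poly p x = x ^ N - x" for x by (simp add: p_def poly_monom)
  have dp: "pderiv p = - 1"
    unfolding p_def by (simp add: pderiv_diff pderiv_monom N(2) pderiv_pCons one_pCons)
  define c where "c = Polynomial.lead_coeff p"
  obtain A where A: "size A = Polynomial.degree p" "p = Polynomial.smult c (\<Prod>x\<in>#A. [:- x, 1:])"
    using alg_closed_imp_factorization[OF p0] unfolding c_def by blast
  have poly_A: "poly p x = c * (\<Prod>y\<in>#A. x - y)" for x
    by (simp add: A(2) poly_prod_mset image_mset.compositionality o_def)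
  have c0: "c \<noteq> 0" using p0 by (simp add: c_def)
  have set_A: "set_mset A = {x. x ^ N = x}"
  proof -
    have "x \<in># A \<longleftrightarrow> x ^ N - x = 0" for x
      using poly_A[of x] c0 by (auto simp: poly_p prod_mset_zero_iff)
    then show ?thesis by auto
  qed
  have count_A: "count A x \<le> 1" for x
  proof (rule ccontr)
    assume "\<not> ?thesis"
    then have "{#x, x#} \<subseteq># A" by (auto simp: subseteq_mset_def)
    then obtain A' where A': "A = {#x, x#} + A'" by (metis mset_subset_eq_exists_conv)
    have "p = Polynomial.smult c ([:- x, 1:] * ([:- x, 1:] * (\<Prod>x\<in>#A'. [:- x, 1:])))"
      by (simp only: A(2) A') simp
    moreover have "poly (pderiv (Polynomial.smult c (L * (L * P)))) x = 0" if "poly L x = 0" for L P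
      using that by (simp add: pderiv_smult pderiv_mult)
    ultimately have "poly (pderiv p) x = 0" 
      by (metis add.left_inverse mult.right_neutral poly_0 poly_pCons mult_zero_right add_0_right)
    then show False by (simp add: dp)
  qed
  then have "size A = card (set_mset A)"
  proof -
    have "count A x = 1" if "x \<in># A" for x
      using count_A[of x] that by (metis count_greater_eq_one_iff le_antisym)
    then show ?thesis by (simp add: size_multiset_overloaded_eq)
  qed
  then show "card {x :: 'f. x ^ N = x} = N" using A(1) deg set_A by simp
  show "finite {x :: 'f. x ^ N = x}" using set_A by (metis finite_set_mset)
qed

text \<open>The field consists of the roots of X^N - X for a power N of the characteristic: closure
  under addition is the freshman's dream, and there are exactly N roots.\<close>

lemma large_finite_subfield:
  obtains K :: "'q::{field,finite} alg_closure set"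
  where "finite K" "card K > n" "subfield_of_type K" "range to_ac \<subseteq> K"
proof -
  define p where "p = CHAR('q)"
  define q where "q = CARD('q)"
  \<comment> \<open>As the exponent is a multiple of \<open>totient (q - 1)\<close>, Euler's theorem
    makes N congruent to 1 modulo \<open>q - 1\<close>, so every element of \<open>'q\<close> is a
    root. The factor \<open>n + 1\<close> makes N exceed \<open>n\<close>.\<close>
  define N where "N = p ^ (totient (q - 1) * (n + 1))"
  have p: "Factorial_Ring.prime p" unfolding p_def
    by (rule prime_CHAR_semidom) (simp add: finite_imp_CHAR_pos)
  have q: "q > 1"
  proof -
    have "card {0, 1 :: 'q} \<le> q" unfolding q_def by (rule card_mono) auto
    then show ?thesis by simp
  qed
  have "p dvd q" unfolding p_def q_def by (rule CHAR_dvd_CARD)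
  have cop: "coprime p (q - 1)"
  proof -
    have "\<not> p dvd q - 1"
    proof
      assume "p dvd q - 1"
      with \<open>p dvd q\<close> have "p dvd q - (q - 1)" by (rule dvd_diff_nat)
      then show False using q p by simp
    qed
    then show ?thesis using p by (simp add: prime_imp_coprime)
  qed
  have tot: "totient (q - 1) \<ge> 1" using q by (simp add: Suc_le_eq)
  then have exp_gt: "totient (q - 1) * (n + 1) \<ge> n + 1"
    using mult_le_mono1[OF tot, of "n + 1"] by simp
  have "N \<ge> 2 ^ (n + 1)"
  proof -
    have "(2::nat) ^ (n + 1) \<le> p ^ (n + 1)" using prime_ge_2_nat[OF p] by (rule power_mono) simp
    also have "\<dots> \<le> N" unfolding N_def using exp_gt prime_gt_0_nat[OF p] by (intro power_increasing) auto
    finally show ?thesis .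
  qed
  then have N: "N > n + 1" using less_exp[of "n + 1"] by linarith
  have char: "CHAR('q alg_closure) = p" by (simp add: p_def)
  have "of_nat N = (0 :: 'q alg_closure)"
    using exp_gt unfolding of_nat_eq_0_iff_char_dvd char N_def by (intro dvd_power) auto
  then have roots: "card {x :: 'q alg_closure. x ^ N = x} = N" "finite {x :: 'q alg_closure. x ^ N = x}"
    using N card_roots_power_minus_id[where 'f = "'q alg_closure"] by auto
  let ?K = "{x :: 'q alg_closure. x ^ N = x}"
  have add: "(x + y) ^ N = x ^ N + y ^ N" for x y :: "'q alg_closure"
    by (rule freshmans_dream') (use p char N_def in auto)
  have "subfield_of_type ?K"
  proof
    fix a :: "'q alg_closure" assume a: "a \<in> ?K"
    have "(- a) ^ N + a ^ N = 0" using add[of "- a" a] N by (simp add: power_0_left)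
    then show "- a \<in> ?K" using a by (simp add: eq_neg_iff_add_eq_0)
  qed (use N add in \<open>auto simp: power_mult_distrib power_inverse\<close>)
  moreover have "to_ac x ^ N = to_ac x" for x :: 'q
  proof (cases "x = 0")
    case False
    have "[p ^ totient (q - 1) = 1] (mod (q - 1))" using cop by (rule euler_theorem)
    then have "[(p ^ totient (q - 1)) ^ (n + 1) = 1 ^ (n + 1)] (mod (q - 1))" by (rule cong_pow)
    then have "[1 = N] (mod (q - 1))" unfolding N_def power_mult power_one by (rule cong_sym)
    then obtain k where "N = 1 + k * (q - 1)"
      using N by (subst (asm) cong_sym_eq, subst (asm) cong_le_nat) auto
    then have "x ^ N = x * (x ^ (q - 1)) ^ k"
      by (simp add: power_add mult.commute[of k] flip: power_mult)
    then have "x ^ N = x" using finite_field_power_card_minus_1[OF False] by (simp add: q_def)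
    then show ?thesis by (metis to_ac_power)
  qed (use N in simp)
  ultimately show ?thesis using that[of ?K] roots N by auto
qed

subsection \<open>Rank and counting\<close>

text \<open>Rank over \<open>K\<close> stated through coefficients in \<open>K\<close>. The dual
  family \<open>u\<close> expresses that the rows in \<open>B\<close> are independent and drives the
  kernel count for sufficiency; the expansions \<open>d\<close> express that they span and drive
  necessity.\<close>

definition row_basis_over :: "'f::field set \<Rightarrow> 'f ^ 'n ^ 'm \<Rightarrow> 'm set \<Rightarrow> bool" where
  "row_basis_over K M B \<longleftrightarrow>
     (\<exists>u. (\<forall>i e. u i e \<in> K) \<and>
        (\<forall>i\<in>B. \<forall>j\<in>B. (\<Sum>e\<in>UNIV. u i e * M $ j $ e) = (if i = j then 1 else 0))) \<and>
     (\<exists>d. (\<forall>i b. d i b \<in> K) \<and> (\<forall>i e. M $ i $ e = (\<Sum>b\<in>B. d i b * M $ b $ e)))"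

text \<open>The entries are 0 and 1, so \<open>to_ac\<close> carries the cut matrix over
  \<open>'q\<close> to the one over the closure, and the identities of a row basis with it. The size
  of \<open>B\<close> therefore stays the rank over \<open>'q\<close> for every extension
  \<open>K\<close>.\<close>

lemma cut_matrix_row_basis:
  fixes K :: "'q::field alg_closure set" and G :: "('v, 'p::finite) adt_graph"
  assumes "range to_ac \<subseteq> K"
  obtains B where "card B = cut_value TYPE('q) G \<Omega>" "row_basis_over K (cut_matrix G \<Omega>) B"
proof -
  let ?M = "cut_matrix G \<Omega> :: 'q ^ 'p ^ 'p" and ?M' = "cut_matrix G \<Omega> :: 'q alg_closure ^ 'p ^ 'p"
  have M': "?M' $ i $ e = to_ac (?M $ i $ e)" for i e by (simp add: cut_matrix_def)
  obtain B u d where B: "card B = rank ?M"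
    "\<And>i j. \<lbrakk>i \<in> B; j \<in> B\<rbrakk> \<Longrightarrow> (\<Sum>e\<in>UNIV. u i e * ?M $ j $ e) = (if i = j then 1 else 0)"
    "\<And>i e. ?M $ i $ e = (\<Sum>b\<in>B. d i b * ?M $ b $ e)"
    using rank_row_basis[of ?M] by blast
  have u: "(\<Sum>e\<in>UNIV. to_ac (u i e) * ?M' $ j $ e) = (if i = j then 1 else 0)"
    if "i \<in> B" "j \<in> B" for i j
    using arg_cong[OF B(2)[OF that], of to_ac] by (simp add: M' to_ac_sum)
  have d: "?M' $ i $ e = (\<Sum>b\<in>B. to_ac (d i b) * ?M' $ b $ e)" for i e
    using arg_cong[OF B(3)[of i e], of to_ac] by (simp add: M' to_ac_sum)
  have "row_basis_over K ?M' B"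
    unfolding row_basis_over_def
  proof
    show "\<exists>u. (\<forall>i e. u i e \<in> K) \<and>
        (\<forall>i\<in>B. \<forall>j\<in>B. (\<Sum>e\<in>UNIV. u i e * ?M' $ j $ e) = (if i = j then 1 else 0))"
      using u assms by (intro exI[of _ "\<lambda>i e. to_ac (u i e)"]) auto
    show "\<exists>d. (\<forall>i b. d i b \<in> K) \<and> (\<forall>i e. ?M' $ i $ e = (\<Sum>b\<in>B. d i b * ?M' $ b $ e))"
      using d assms by (intro exI[of _ "\<lambda>i e. to_ac (d i e)"]) blast
  qed
  with B(1) show ?thesis by (intro that[of B]) (simp_all add: cut_value_def)
qed

locale finite_subfield_of_type = subfield_of_type K for K :: "'f::field set" +
  assumes finite_K [simp]: "finite K"
begin

lemma card_K_gt_1: "card K > 1"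
proof -
  have "card {0, 1 :: 'f} \<le> card K" by (rule card_mono) auto
  then show ?thesis by simp
qed

text \<open>Rank-nullity by counting: adding the combinations of the \<open>u b\<close> to the
  kernel vectors gives distinct vectors, since applying the rows in \<open>B\<close> recovers the
  coefficients.\<close>

lemma card_kernel_le:
  fixes M :: "'f ^ 'n ^ 'm"
  assumes B: "row_basis_over K M B"
    and supp: "\<And>i e. e \<notin> P \<Longrightarrow> M $ i $ e = 0"
  defines "Ker \<equiv> {y. (\<forall>e\<in>P. y e \<in> K) \<and> (\<forall>e. e \<notin> P \<longrightarrow> y e = 0) \<and> (\<forall>i. (\<Sum>e\<in>UNIV. M $ i $ e * y e) = 0)}"
  shows "finite Ker" "card Ker * card K ^ card B \<le> card K ^ card P"
proof -
  obtain u where uK: "\<And>i e. u i e \<in> K"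
    and u: "\<And>i j. \<lbrakk>i \<in> B; j \<in> B\<rbrakk> \<Longrightarrow> (\<Sum>e\<in>UNIV. u i e * M $ j $ e) = (if i = j then 1 else 0)"
    using B unfolding row_basis_over_def by blast
  \<comment> \<open>The vectors \<open>u b\<close> may be nonzero outside \<open>P\<close>; cutting
    them off there does not affect products with \<open>M\<close>, whose columns outside
    \<open>P\<close> are zero.\<close>
  define f where "f = (\<lambda>(y :: 'n \<Rightarrow> 'f, t). restrict (\<lambda>e. y e + (\<Sum>b\<in>B. t b * u b e)) P)"
  have row: "(\<Sum>e\<in>UNIV. M $ j $ e * f (y, t) e) = t j" if "y \<in> Ker" "j \<in> B" for y t j
  proof -
    have "(\<Sum>e\<in>UNIV. M $ j $ e * f (y, t) e) = (\<Sum>e\<in>UNIV. M $ j $ e * (y e + (\<Sum>b\<in>B. t b * u b e)))"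
      by (intro sum.cong) (auto simp: f_def supp)
    also have "\<dots> = (\<Sum>e\<in>UNIV. M $ j $ e * y e) + (\<Sum>b\<in>B. t b * (\<Sum>e\<in>UNIV. u b e * M $ j $ e))"
      by (simp add: algebra_simps sum.distrib sum_distrib_left sum_distrib_right sum.swap[of _ B])
    also have "(\<Sum>e\<in>UNIV. M $ j $ e * y e) = 0"
      using that by (simp add: Ker_def)
    also have "(\<Sum>b\<in>B. t b * (\<Sum>e\<in>UNIV. u b e * M $ j $ e)) = (\<Sum>b\<in>B. if b = j then t b else 0)"
      using that u by (intro sum.cong) auto
    finally show ?thesis using that by simp
  qed
  have inj: "inj_on f (Ker \<times> (B \<rightarrow>\<^sub>E K))"
  proof (rule inj_onI, clarify)
    fix y t y' t' assume yt: "y \<in> Ker" "t \<in> B \<rightarrow>\<^sub>E K" "y' \<in> Ker" "t' \<in> B \<rightarrow>\<^sub>E K" "f (y, t) = f (y', t')"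
    have tt': "t = t'"
      using row[OF yt(1)] row[OF yt(3)] yt(2,4,5) by (intro PiE_ext[OF yt(2,4)]) metis
    have "y e = y' e" for e
      using yt(1,3) fun_cong[OF yt(5), of e] by (cases "e \<in> P") (auto simp: f_def tt' Ker_def)
    then show "y = y' \<and> t = t'" using tt' by auto
  qed
  have sub: "f ` (Ker \<times> (B \<rightarrow>\<^sub>E K)) \<subseteq> P \<rightarrow>\<^sub>E K"
  proof (rule image_subsetI, clarify)
    fix y t assume "y \<in> Ker" and t: "t \<in> B \<rightarrow>\<^sub>E K"
    then have "y e \<in> K" if "e \<in> P" for e using that by (simp add: Ker_def)
    moreover have "t b \<in> K" if "b \<in> B" for b using t that by (rule PiE_mem)
    ultimately show "f (y, t) \<in> P \<rightarrow>\<^sub>E K"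
      using uK by (simp add: f_def restrict_PiE_iff add_closed sum_closed mult_closed)
  qed
  have fin: "finite (P \<rightarrow>\<^sub>E K)" by (intro finite_PiE) auto
  have "finite (Ker \<times> (B \<rightarrow>\<^sub>E K))"
    using finite_imageD[OF finite_subset[OF sub fin] inj] .
  moreover have "(B \<rightarrow>\<^sub>E K) \<noteq> {}" by (auto simp: PiE_eq_empty_iff)
  ultimately show "finite Ker" using finite_cartesian_productD1 by blast
  have "card (Ker \<times> (B \<rightarrow>\<^sub>E K)) \<le> card (P \<rightarrow>\<^sub>E K)"
    by (rule card_inj_on_le[OF inj sub fin])
  then show "card Ker * card K ^ card B \<le> card K ^ card P"
    by (simp add: card_cartesian_product card_funcsetE)
qed

text \<open>As \<open>w d0\<close> is nonzero, the equation determines the coordinate at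
  \<open>d0\<close> from the others.\<close>

lemma card_hyperplane_le:
  assumes "finite D" "d0 \<in> D" "w d0 \<noteq> 0"
  shows "card {v \<in> D \<rightarrow>\<^sub>E K. (\<Sum>d\<in>D. v d * w d) = s} * card K \<le> card (D \<rightarrow>\<^sub>E K)"
proof -
  let ?H = "{v \<in> D \<rightarrow>\<^sub>E K. (\<Sum>d\<in>D. v d * w d) = s}" and ?D' = "D - {d0}"
  have inj: "inj_on (\<lambda>v. restrict v ?D') ?H"
  proof (rule inj_onI)
    fix v v' assume v: "v \<in> ?H" "v' \<in> ?H" "restrict v ?D' = restrict v' ?D'"
    have eq: "v d = v' d" if "d \<in> ?D'" for d using fun_cong[OF v(3), of d] that by simp
    then have "(\<Sum>d\<in>?D'. v d * w d) = (\<Sum>d\<in>?D'. v' d * w d)" by (intro sum.cong) auto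
    moreover have "(\<Sum>d\<in>D. v d * w d) = (\<Sum>d\<in>D. v' d * w d)" using v(1,2) by simp
    ultimately have "v d0 * w d0 = v' d0 * w d0"
      using assms(1,2) by (simp add: sum.remove)
    then have "v d0 = v' d0" using assms(3) by simp
    then show "v = v'" using v(1,2) eq by (intro PiE_ext[of v D "\<lambda>_. K" v']) auto
  qed
  have "card ?H \<le> card (?D' \<rightarrow>\<^sub>E K)"
    using assms(1) by (intro card_inj_on_le[OF inj] finite_PiE image_subsetI) (auto simp: restrict_PiE_iff PiE_mem)
  then have "card ?H * card K \<le> card K ^ (card D - 1) * card K"
    using assms(1,2) by (simp add: card_funcsetE)
  also have "\<dots> = card K ^ card D"
    using assms(1,2) by (metis card_gt_0_iff empty_iff power_minus_mult)
  finally show ?thesis using assms(1) by (simp add: card_funcsetE)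
qed

text \<open>The equation at port \<open>e\<close> involves only the coefficients \<open>c e\<close>.
  Different ports thus act independently, and each port of \<open>P\<close> contributes a factor of
  at most \<open>1 / card K\<close>.\<close>

lemma card_codes_le:
  fixes w :: "'p::finite \<Rightarrow> 'd \<Rightarrow> 'f"
  assumes "finite D" and "\<And>e. e \<in> P \<Longrightarrow> \<exists>d\<in>D. w e d \<noteq> 0"
  shows "card {c \<in> UNIV \<rightarrow>\<^sub>E (D \<rightarrow>\<^sub>E K). \<forall>e\<in>P. (\<Sum>d\<in>D. c e d * w e d) = y e} * card K ^ card P
    \<le> card ((UNIV :: 'p set) \<rightarrow>\<^sub>E (D \<rightarrow>\<^sub>E K))"
proof -
  define H where "H e = (if e \<in> P then {v \<in> D \<rightarrow>\<^sub>E K. (\<Sum>d\<in>D. v d * w e d) = y e} else D \<rightarrow>\<^sub>E K)" for e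
  have fin: "finite (D \<rightarrow>\<^sub>E K)" using assms(1) by (intro finite_PiE) auto
  have finH: "finite (H e)" for e using fin by (simp add: H_def)
  have "{c \<in> UNIV \<rightarrow>\<^sub>E (D \<rightarrow>\<^sub>E K). \<forall>e\<in>P. (\<Sum>d\<in>D. c e d * w e d) = y e} \<subseteq> Pi\<^sub>E UNIV H"
    by (auto simp: H_def PiE_iff)
  then have "card {c \<in> UNIV \<rightarrow>\<^sub>E (D \<rightarrow>\<^sub>E K). \<forall>e\<in>P. (\<Sum>d\<in>D. c e d * w e d) = y e} * card K ^ card P
      \<le> card (Pi\<^sub>E UNIV H) * card K ^ card P"
    using finH by (intro mult_right_mono card_mono finite_PiE) auto
  also have "\<dots> = (\<Prod>e\<in>UNIV. card (H e)) * (\<Prod>e\<in>UNIV. if e \<in> P then card K else 1)"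
    by (simp add: card_PiE prod.If_cases)
  also have "\<dots> = (\<Prod>e\<in>UNIV. card (H e) * (if e \<in> P then card K else 1))"
    by (simp add: prod.distrib)
  also have "\<dots> \<le> (\<Prod>e\<in>(UNIV :: 'p set). card (D \<rightarrow>\<^sub>E K))"
  proof (intro prod_mono conjI)
    fix e :: 'p
    show "card (H e) * (if e \<in> P then card K else 1) \<le> card (D \<rightarrow>\<^sub>E K)"
    proof (cases "e \<in> P")
      case True
      then obtain d0 where "d0 \<in> D" "w e d0 \<noteq> 0" using assms(2) by blast
      then show ?thesis using card_hyperplane_le[OF assms(1), of d0 "w e" "y e"] True by (simp add: H_def)
    qed (simp add: H_def)
  qed simp
  finally show ?thesis by (simp add: card_PiE)
qed

lemma card_normalized_le:
  assumes "finite I" "j \<in> I"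
  shows "finite {x. (\<forall>i\<in>I. x i \<in> K) \<and> (\<forall>i. i \<notin> I \<longrightarrow> x i = 0) \<and> x j = 1}" (is "finite ?X")
    "card {x. (\<forall>i\<in>I. x i \<in> K) \<and> (\<forall>i. i \<notin> I \<longrightarrow> x i = 0) \<and> x j = 1} * card K \<le> card K ^ card I"
proof -
  let ?f = "\<lambda>x. restrict x (I - {j})"
  have inj: "inj_on ?f ?X"
  proof (rule inj_onI, rule ext)
    fix x x' i assume x: "x \<in> ?X" "x' \<in> ?X" "?f x = ?f x'"
    show "x i = x' i"
      using fun_cong[OF x(3), of i] x(1,2) by (cases "i \<in> I - {j}") auto
  qed
  have sub: "?f ` ?X \<subseteq> (I - {j}) \<rightarrow>\<^sub>E K"
    by (intro image_subsetI) (auto simp: restrict_PiE_iff)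
  have fin: "finite ((I - {j}) \<rightarrow>\<^sub>E K)" using assms(1) by (intro finite_PiE) auto
  show "finite ?X" using finite_imageD[OF finite_subset[OF sub fin] inj] .
  have "card ?X \<le> card ((I - {j}) \<rightarrow>\<^sub>E K)" by (rule card_inj_on_le[OF inj sub fin])
  then have "card ?X * card K \<le> card K ^ (card I - 1) * card K"
    using assms by (simp add: card_funcsetE)
  also have "\<dots> = card K ^ card I"
    using assms by (metis card_gt_0_iff empty_iff power_minus_mult)
  finally show "card ?X * card K \<le> card K ^ card I" .
qed

end

subsection \<open>Transmission in acyclic networks\<close>

lemma transmission_cong:
  assumes "transmission G \<S> \<mu> \<alpha> \<beta> x Y"
    and "\<And>S i. \<lbrakk>S \<in> \<S>; i < \<mu> S\<rbrakk> \<Longrightarrow> x S i = x' S i"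
    and "\<And>S i e. \<lbrakk>S \<in> \<S>; i < \<mu> S\<rbrakk> \<Longrightarrow> \<alpha> i e = \<alpha>' i e"
  shows "transmission G \<S> \<mu> \<alpha>' \<beta> x' Y"
proof -
  have "(\<Sum>i<\<mu> V. \<alpha> i e * x V i) = (\<Sum>i<\<mu> V. \<alpha>' i e * x' V i)" if "V \<in> \<S>" for V e
    using assms(2,3) that by (intro sum.cong) auto
  then have "(if V \<in> \<S> then \<Sum>i<\<mu> V. \<alpha> i e * x V i else 0) =
      (if V \<in> \<S> then \<Sum>i<\<mu> V. \<alpha>' i e * x' V i else 0)" for V e by simp
  then show ?thesis using assms(1) unfolding transmission_def by simp
qed

text \<open>Combining the responses to unit inputs in this way gives, for a fixed code, solutions
  that are linear in the input by construction.\<close>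

lemma transmission_sum:
  assumes "finite J" "\<And>j. j \<in> J \<Longrightarrow> transmission G \<S> \<mu> \<alpha> \<beta> (x j) (Y j)"
  shows "transmission G \<S> \<mu> \<alpha> \<beta> (\<lambda>S i. \<Sum>j\<in>J. t j * x j S i) (\<lambda>e. \<Sum>j\<in>J. t j * Y j e)"
  unfolding transmission_def
proof (intro conjI ballI)
  fix V e assume V: "V \<in> nodes G" and e: "e \<in> outp G V"
  have "(\<Sum>j\<in>J. t j * Y j e) =
      (\<Sum>j\<in>J. t j * ((\<Sum>e'\<in>inp G V. \<beta> e' e * Y j e') + (if V \<in> \<S> then \<Sum>i<\<mu> V. \<alpha> i e * x j V i else 0)))"
    using assms(2) V e unfolding transmission_def by (intro sum.cong) auto
  also have "\<dots> = (\<Sum>j\<in>J. \<Sum>e'\<in>inp G V. \<beta> e' e * (t j * Y j e')) +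
      (if V \<in> \<S> then \<Sum>j\<in>J. \<Sum>i<\<mu> V. \<alpha> i e * (t j * x j V i) else 0)"
    by (simp add: sum.distrib sum_distrib_left algebra_simps)
  also have "\<dots> = (\<Sum>e'\<in>inp G V. \<beta> e' e * (\<Sum>j\<in>J. t j * Y j e')) +
      (if V \<in> \<S> then \<Sum>i<\<mu> V. \<alpha> i e * (\<Sum>j\<in>J. t j * x j V i) else 0)"
    by (simp add: sum_distrib_left sum.swap[of _ J])
  finally show "(\<Sum>j\<in>J. t j * Y j e) = (\<Sum>e'\<in>inp G V. \<beta> e' e * (\<Sum>j\<in>J. t j * Y j e')) +
      (if V \<in> \<S> then \<Sum>i<\<mu> V. \<alpha> i e * (\<Sum>j\<in>J. t j * x j V i) else 0)" .
next
  fix V e' assume "V \<in> nodes G" "e' \<in> inp G V"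
  then have "(\<Sum>j\<in>J. t j * Y j e') = (\<Sum>j\<in>J. t j * (\<Sum>e | (e, e') \<in> edges G. Y j e))"
    using assms(2) unfolding transmission_def by (intro sum.cong) auto
  then show "(\<Sum>j\<in>J. t j * Y j e') = (\<Sum>e | (e, e') \<in> edges G. \<Sum>j\<in>J. t j * Y j e)"
    by (simp add: sum_distrib_left sum.swap[of _ J])
qed

section \<open>Solutions of the network equations, and their behaviour at a cut\<close>

context adt_network
begin

lemma wf_node_rel: "wf (node_rel G)"
proof -
  have "node_rel G \<subseteq> nodes G \<times> nodes G" by (auto simp: node_rel_def)
  then have "finite (node_rel G)" using finite_nodes by (simp add: finite_subset)
  then show ?thesis using acyclic by (rule finite_acyclic_wf)
qed

lemma node_induct [consumes 1, case_names node]: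
  assumes "V \<in> nodes G"
    and "\<And>V. \<lbrakk>V \<in> nodes G; \<And>W. \<lbrakk>W \<in> nodes G; (W, V) \<in> node_rel G\<rbrakk> \<Longrightarrow> P W\<rbrakk> \<Longrightarrow> P V"
  shows "P V"
  using wf_node_rel assms(1) by (induction V rule: wf_induct_rule) (auto intro: assms(2))

lemma outp_unique: "\<lbrakk>V \<in> nodes G; W \<in> nodes G; e \<in> outp G V; e \<in> outp G W\<rbrakk> \<Longrightarrow> V = W"
  using ports_disjoint by blast

lemma inp_not_outp: "\<lbrakk>V \<in> nodes G; W \<in> nodes G; e \<in> inp G V\<rbrakk> \<Longrightarrow> e \<notin> outp G W"
  using ports_disjoint inp_outp_disjoint by (cases "V = W") blast+

lemma edge_source:
  assumes "(e, e') \<in> edges G"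
  obtains W where "W \<in> nodes G" "e \<in> outp G W"
  using assms edges_subset by blast

text \<open>Well-founded recursion over the nodes, which acyclicity permits. It computes only the
  symbols \<open>I V\<close> at input ports; output symbols are expressed from them by
  \<open>send\<close>.\<close>

lemma transmission_exists:
  fixes \<alpha> :: "nat \<Rightarrow> 'p \<Rightarrow> 'f::field"
  shows "\<exists>Y. transmission G \<S> \<mu> \<alpha> \<beta> x Y"
proof -
  define owner where "owner e = (THE V. V \<in> nodes G \<and> e \<in> inp G V \<union> outp G V)" for e
  have owner: "owner e = V" if "V \<in> nodes G" "e \<in> inp G V \<union> outp G V" for e V
    unfolding owner_def by (rule the_equality) (use that ports_disjoint in blast)+
  define send where "send I V e =
      (\<Sum>e'\<in>inp G V. \<beta> e' e * I V e') + (if V \<in> \<S> then \<Sum>i<\<mu> V. \<alpha> i e * x V i else 0)"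
    for I :: "'v \<Rightarrow> 'p \<Rightarrow> 'f" and V e
  define F where "F I V = (\<lambda>e'. \<Sum>e | (e, e') \<in> edges G. send I (owner e) e)" for I and V :: 'v
  define I where "I = wfrec (node_rel G) F"
  have I: "I V e' = (\<Sum>e | (e, e') \<in> edges G. send I (owner e) e)" if "V \<in> nodes G" "e' \<in> inp G V" for V e'
  proof -
    \<comment> \<open>Truncating the recursion to predecessors of \<open>V\<close> is harmless:
      every edge into a port of \<open>V\<close> starts at a node related to
      \<open>V\<close>.\<close>
    have "I V e' = F (cut I (node_rel G) V) V e'"
      unfolding I_def by (subst wfrec[OF wf_node_rel]) simp
    also have "\<dots> = (\<Sum>e | (e, e') \<in> edges G. send I (owner e) e)"
      unfolding F_def
    proof (intro sum.cong refl)
      fix e assume e: "e \<in> {e. (e, e') \<in> edges G}"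
      then obtain W where W: "W \<in> nodes G" "e \<in> outp G W" using edge_source by blast
      then have "owner e = W" by (intro owner) auto
      moreover have "(W, V) \<in> node_rel G" using W e that by (auto simp: node_rel_def)
      ultimately show "send (cut I (node_rel G) V) (owner e) e = send I (owner e) e"
        by (simp add: send_def cut_apply)
    qed
    finally show ?thesis .
  qed
  define Y where "Y e = (if e \<in> (\<Union>V\<in>nodes G. outp G V) then send I (owner e) e else I (owner e) e)" for e
  have Y_out: "Y e = send I V e" if "V \<in> nodes G" "e \<in> outp G V" for V e
    using that owner[of V e] by (auto simp: Y_def)
  have Y_in: "Y e = I V e" if "V \<in> nodes G" "e \<in> inp G V" for V e
    using that owner[of V e] inp_not_outp by (auto simp: Y_def)
  show ?thesis
  proof (intro exI[of _ Y], unfold transmission_def, intro conjI ballI)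
    fix V e assume V: "V \<in> nodes G" "e \<in> outp G V"
    then show "Y e = (\<Sum>e'\<in>inp G V. \<beta> e' e * Y e') + (if V \<in> \<S> then \<Sum>i<\<mu> V. \<alpha> i e * x V i else 0)"
      using Y_in[OF V(1)] by (simp add: Y_out send_def)
  next
    fix V e' assume V: "V \<in> nodes G" "e' \<in> inp G V"
    have "Y e = send I (owner e) e" if "(e, e') \<in> edges G" for e
      using that edge_source by (metis Y_out UnI2 owner)
    then show "Y e' = (\<Sum>e | (e, e') \<in> edges G. Y e)"
      using V by (simp add: Y_in I)
  qed
qed

text \<open>Induction along the network. Only ports of nodes are covered, since elsewhere the
  equations leave a solution arbitrary.\<close>

lemma transmission_closed:
  assumes "subfield_of_type K" "transmission G \<S> \<mu> \<alpha> \<beta> x Y"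
    and "\<And>S i e. \<lbrakk>S \<in> \<S>; i < \<mu> S\<rbrakk> \<Longrightarrow> \<alpha> i e \<in> K" "\<And>e' e. \<beta> e' e \<in> K"
    and "\<And>S i. \<lbrakk>S \<in> \<S>; i < \<mu> S\<rbrakk> \<Longrightarrow> x S i \<in> K"
    and "V \<in> nodes G" "e \<in> inp G V \<union> outp G V"
  shows "Y e \<in> K"
proof -
  interpret subfield_of_type K by fact
  have out: "Y e \<in> K" if "W \<in> nodes G" "e \<in> outp G W" "\<forall>e'\<in>inp G W. Y e' \<in> K" for W e
  proof -
    have "Y e = (\<Sum>e'\<in>inp G W. \<beta> e' e * Y e') + (if W \<in> \<S> then \<Sum>i<\<mu> W. \<alpha> i e * x W i else 0)"
      using assms(2) that unfolding transmission_def by blast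
    also have "\<dots> \<in> K" using that assms(3-5) by auto
    finally show ?thesis .
  qed
  have inp: "\<forall>e'\<in>inp G V. Y e' \<in> K" if "V \<in> nodes G" for V
    using that
  proof (induction V rule: node_induct)
    case (node V)
    show ?case
    proof
      fix e' assume e': "e' \<in> inp G V"
      then have "Y e' = (\<Sum>e | (e, e') \<in> edges G. Y e)"
        using assms(2) node(1) unfolding transmission_def by blast
      also have "\<dots> \<in> K"
      proof (rule sum_closed)
        fix e assume e: "e \<in> {e. (e, e') \<in> edges G}"
        then obtain W where W: "W \<in> nodes G" "e \<in> outp G W" using edge_source by blast
        then have "(W, V) \<in> node_rel G" using e e' node(1) by (auto simp: node_rel_def)
        then show "Y e \<in> K" using out W node(2) by blast
      qed
      finally show "Y e' \<in> K" .
    qed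
  qed
  show ?thesis using assms(6,7) inp out by blast
qed

lemma cut_matrix_eq_0:
  "e \<notin> (\<Union>V\<in>\<Omega>. outp G V) \<Longrightarrow> cut_matrix G \<Omega> $ i $ e = 0"
  by (simp add: cut_matrix_def)

text \<open>Each edge into \<open>e'\<close> starts on exactly one side of the cut; those from
  \<open>\<Omega>\<close> make up row \<open>e'\<close> of the cut matrix.\<close>

lemma transmission_across_cut:
  assumes "transmission G \<S> \<mu> \<alpha> \<beta> x Y" "\<Omega> \<subseteq> nodes G" "V \<in> nodes G - \<Omega>" "e' \<in> inp G V"
  shows "Y e' = (\<Sum>e\<in>UNIV. cut_matrix G \<Omega> $ e' $ e * Y e) +
    (\<Sum>e | (e, e') \<in> edges G \<and> e \<in> (\<Union>W\<in>nodes G - \<Omega>. outp G W). Y e)"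
proof -
  let ?P = "\<Union>V\<in>\<Omega>. outp G V" and ?Q = "\<Union>W\<in>nodes G - \<Omega>. outp G W"
  let ?A = "{e. (e, e') \<in> edges G \<and> e \<in> ?P}" and ?B = "{e. (e, e') \<in> edges G \<and> e \<in> ?Q}"
  have "Y e' = (\<Sum>e | (e, e') \<in> edges G. Y e)"
    using assms unfolding transmission_def by blast
  also have "{e. (e, e') \<in> edges G} = ?A \<union> ?B"
    by (auto elim: edge_source)
  also have "(\<Sum>e\<in>?A \<union> ?B. Y e) = (\<Sum>e\<in>?A. Y e) + (\<Sum>e\<in>?B. Y e)"
  proof (rule sum.union_disjoint)
    show "?A \<inter> ?B = {}" using assms(2) outp_unique by blast
  qed auto
  also have "(\<Sum>e\<in>?A. Y e) = (\<Sum>e\<in>UNIV. if e \<in> ?A then Y e else 0)"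
    by (simp add: sum.If_cases)
  also have "\<dots> = (\<Sum>e\<in>UNIV. cut_matrix G \<Omega> $ e' $ e * Y e)"
    using assms(3,4) by (intro sum.cong) (auto simp: cut_matrix_def)
  finally show ?thesis .
qed

text \<open>What enters a node beyond the cut is the flow through the cut plus symbols sent by
  earlier nodes beyond it, and those depend only on their own inputs and processes. Induction along
  the network applies.\<close>

lemma inputs_eq_of_cut_flow_eq:
  assumes Y: "transmission G \<S> \<mu> \<alpha> \<beta> x Y" and Y': "transmission G \<S> \<mu> \<alpha> \<beta> x' Y'"
    and \<Omega>: "\<Omega> \<subseteq> nodes G"
    and x: "\<And>S i. \<lbrakk>S \<in> \<S> - \<Omega>; i < \<mu> S\<rbrakk> \<Longrightarrow> x S i = x' S i"
    and flow: "\<And>e'. (\<Sum>e\<in>UNIV. cut_matrix G \<Omega> $ e' $ e * Y e) = (\<Sum>e\<in>UNIV. cut_matrix G \<Omega> $ e' $ e * Y' e)"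
    and V: "V \<in> nodes G" "V \<notin> \<Omega>"
  shows "\<forall>e'\<in>inp G V. Y e' = Y' e'"
  using V
proof (induction V rule: node_induct)
  case (node V)
  show ?case
  proof
    fix e' assume e': "e' \<in> inp G V"
    let ?B = "{e. (e, e') \<in> edges G \<and> e \<in> (\<Union>W\<in>nodes G - \<Omega>. outp G W)}"
    have "(\<Sum>e\<in>?B. Y e) = (\<Sum>e\<in>?B. Y' e)"
    proof (rule sum.cong)
      fix e assume e: "e \<in> ?B"
      then obtain W where W: "W \<in> nodes G - \<Omega>" "e \<in> outp G W" by blast
      then have "(W, V) \<in> node_rel G" using e e' node(1) by (auto simp: node_rel_def)
      then have "\<forall>e'\<in>inp G W. Y e' = Y' e'" using node(2) W by blast
      then have "(\<Sum>e'\<in>inp G W. \<beta> e' e * Y e') = (\<Sum>e'\<in>inp G W. \<beta> e' e * Y' e')" by simp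
      moreover have "(if W \<in> \<S> then \<Sum>i<\<mu> W. \<alpha> i e * x W i else 0) = (if W \<in> \<S> then \<Sum>i<\<mu> W. \<alpha> i e * x' W i else 0)"
        using x[of W] W by auto
      moreover have step: "Z e = (\<Sum>e'\<in>inp G W. \<beta> e' e * Z e') + (if W \<in> \<S> then \<Sum>i<\<mu> W. \<alpha> i e * z W i else 0)"
        if "transmission G \<S> \<mu> \<alpha> \<beta> z Z" for z Z
        using that W unfolding transmission_def by blast
      ultimately show "Y e = Y' e"
        by (simp only: step[OF Y] step[OF Y'])
    qed simp
    then show "Y e' = Y' e'"
      using transmission_across_cut[OF Y \<Omega> _ e'] transmission_across_cut[OF Y' \<Omega> _ e'] node flow[of e']
      by simp
  qed
qed

end

subsection \<open>Counting codes\<close>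

locale multicast_network = adt_network G + finite_subfield_of_type K
  for G :: "('v, 'p::finite) adt_graph" and K :: "'f::field set" +
  fixes \<S> :: "'v set" and \<mu> :: "'v \<Rightarrow> nat"
  assumes sources_subset: "\<S> \<subseteq> nodes G"
begin

section \<open>Necessity: pigeonhole on the flow through a cut\<close>

lemma finite_sources: "finite \<S>"
  using sources_subset finite_nodes by (rule finite_subset)

text \<open>Decoding makes the inputs of \<open>\<S>'\<close> inject into the flows through the cut,
  and by the expansions \<open>d\<close> a flow is determined by its entries at the rows in
  \<open>B\<close>.\<close>

lemma solvable_over_imp_rate_le:
  assumes solv: "solvable_over K G \<S> \<mu> (multicast_connections \<S> \<T> \<mu>)"
    and T: "T \<in> \<T>" and \<S>': "\<S>' \<subseteq> \<S>" and cut: "is_cut G \<S>' T \<Omega>"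
    and B: "row_basis_over K (cut_matrix G \<Omega>) B"
  shows "(\<Sum>S\<in>\<S>'. \<mu> S) \<le> card B"
proof -
  obtain \<alpha> \<beta> \<epsilon> \<nu> Y where \<alpha>: "\<forall>i e. \<alpha> i e \<in> K" and \<beta>: "\<forall>e' e. \<beta> e' e \<in> K"
    and Y: "\<forall>x. (\<forall>S i. x S i \<in> K) \<longrightarrow> transmission G \<S> \<mu> \<alpha> \<beta> x (Y x)"
    and dec: "\<forall>(S, T, D)\<in>multicast_connections \<S> \<T> \<mu>. \<forall>i\<in>D. \<exists>k<\<nu> T. \<forall>x. (\<forall>S i. x S i \<in> K) \<longrightarrow>
           destination_output G \<epsilon> (Y x) T k = x S i"
    using solv unfolding solvable_over_def by (elim exE conjE) (rule that)
  have code: "\<alpha> i e \<in> K" "\<beta> e' e \<in> K" for i e e' using \<alpha> \<beta> by blast+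
  have Y: "transmission G \<S> \<mu> \<alpha> \<beta> x (Y x)" if "\<And>S i. x S i \<in> K" for x
    using Y that by blast
  let ?M = "cut_matrix G \<Omega> :: 'f ^ 'p ^ 'p"
  obtain d where d: "\<And>i e. ?M $ i $ e = (\<Sum>b\<in>B. d i b * ?M $ b $ e)"
    using B unfolding row_basis_over_def by blast
  have \<Omega>: "\<Omega> \<subseteq> nodes G" "\<S>' \<subseteq> \<Omega>" "T \<in> nodes G" "T \<notin> \<Omega>"
    using cut by (auto simp: is_cut_def)
  define I where "I = Sigma \<S>' (\<lambda>S. {..<\<mu> S})"
  \<comment> \<open>Sources outside \<open>\<S>'\<close> send zero, so any two such inputs agree at
    all sources beyond the cut.\<close>
  define inject where "inject z S i = (if (S, i) \<in> I then z (S, i) else 0 :: 'f)" for z S i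
  define \<Phi> where "\<Phi> z = restrict (\<lambda>b. \<Sum>e\<in>UNIV. ?M $ b $ e * Y (inject z) e) B" for z
  have injectK: "inject z S i \<in> K" if "z \<in> I \<rightarrow>\<^sub>E K" for z S i
    using that by (auto simp: inject_def)
  have inj: "inj_on \<Phi> (I \<rightarrow>\<^sub>E K)"
  proof (rule inj_onI)
    fix z z' assume z: "z \<in> I \<rightarrow>\<^sub>E K" "z' \<in> I \<rightarrow>\<^sub>E K" "\<Phi> z = \<Phi> z'"
    note tr = Y[OF injectK[OF z(1)]] Y[OF injectK[OF z(2)]]
    have flow: "(\<Sum>e\<in>UNIV. ?M $ e' $ e * Y (inject z) e) = (\<Sum>b\<in>B. d e' b * \<Phi> z b)" for e' z
    proof -
      have "(\<Sum>e\<in>UNIV. ?M $ e' $ e * Y (inject z) e) =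
          (\<Sum>e\<in>UNIV. (\<Sum>b\<in>B. d e' b * ?M $ b $ e) * Y (inject z) e)"
        by (simp flip: d)
      also have "\<dots> = (\<Sum>b\<in>B. d e' b * (\<Sum>e\<in>UNIV. ?M $ b $ e * Y (inject z) e))"
        by (simp add: sum_distrib_left sum_distrib_right mult.assoc sum.swap[of _ B])
      finally show ?thesis by (simp add: \<Phi>_def)
    qed
    have inputs: "\<forall>e'\<in>inp G T. Y (inject z) e' = Y (inject z') e'"
    proof (rule inputs_eq_of_cut_flow_eq[OF tr \<Omega>(1) _ _ \<Omega>(3,4)])
      show "inject z S i = inject z' S i" if "S \<in> \<S> - \<Omega>" for S i
        using that \<Omega>(2) by (auto simp: inject_def I_def)
    qed (simp add: flow z(3))
    show "z = z'"
    proof (rule PiE_ext[OF z(1,2)], clarify)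
      fix S i assume Si: "(S, i) \<in> I"
      then have "(S, T, {..<\<mu> S}) \<in> multicast_connections \<S> \<T> \<mu>" "i \<in> {..<\<mu> S}"
        using T \<S>' by (auto simp: multicast_connections_def I_def)
      then have "\<exists>k<\<nu> T. \<forall>x. (\<forall>S i. x S i \<in> K) \<longrightarrow> destination_output G \<epsilon> (Y x) T k = x S i"
        using bspec[OF dec, of "(S, T, {..<\<mu> S})"] by simp
      then obtain k where k: "\<forall>x. (\<forall>S i. x S i \<in> K) \<longrightarrow> destination_output G \<epsilon> (Y x) T k = x S i"
        by (elim exE conjE)
      have "destination_output G \<epsilon> (Y (inject z)) T k = destination_output G \<epsilon> (Y (inject z')) T k"
        using inputs by (simp add: destination_output_def)
      then have "inject z S i = inject z' S i" using k injectK z(1,2) by simp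
      then show "z (S, i) = z' (S, i)" using Si by (simp add: inject_def)
    qed
  qed
  have sub: "\<Phi> ` (I \<rightarrow>\<^sub>E K) \<subseteq> B \<rightarrow>\<^sub>E K"
  proof (rule image_subsetI)
    fix z assume z: "z \<in> I \<rightarrow>\<^sub>E K"
    have "?M $ b $ e * Y (inject z) e \<in> K" for b e
    \<comment> \<open>At an output port of \<open>\<Omega>\<close> the symbol lies in
      \<open>K\<close>; at any other port the column of the matrix is zero, whatever the
      symbol.\<close>
    proof (cases "\<exists>V\<in>\<Omega>. e \<in> outp G V")
      case True
      then obtain V where V: "V \<in> nodes G" "e \<in> outp G V" using \<Omega>(1) by blast
      have "Y (inject z) e \<in> K"
        by (rule transmission_closed[OF subfield_of_type_axioms Y[OF injectK[OF z]] code injectK[OF z] V(1)])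
          (use V(2) in blast)
      then show ?thesis by (simp add: cut_matrix_def)
    qed (auto simp: cut_matrix_def)
    then show "\<Phi> z \<in> B \<rightarrow>\<^sub>E K" by (simp add: \<Phi>_def restrict_PiE_iff sum_closed)
  qed
  have fin: "finite I" using \<S>' finite_sources finite_subset by (auto simp: I_def)
  have "card (I \<rightarrow>\<^sub>E K) \<le> card (B \<rightarrow>\<^sub>E K)"
    by (rule card_inj_on_le[OF inj sub]) (simp add: finite_PiE)
  then have "card K ^ card I \<le> card K ^ card B"
    using fin by (simp add: card_funcsetE)
  then have "card I \<le> card B" using card_K_gt_1 by simp
  then show ?thesis
    unfolding I_def using \<S>' finite_sources finite_subset by (subst (asm) card_SigmaI) auto
qed

text \<open>
  A code is encoded as a function \<open>c\<close> giving each output port \<open>e\<close> a vector of local coefficients: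
  \<open>c e (Inl i)\<close> is \<open>\<alpha>\<^bsub>(i,e)\<^esub>\<close> and \<open>c e (Inr e')\<close> is \<open>\<beta>\<^bsub>(e',e)\<^esub>\<close>. All ports share the same index set, so
  that the number of codes is a power; the superfluous coefficients meet zeros of \<open>received\<close>.
\<close>

definition code_index :: "(nat + 'p) set" where
  "code_index = Inl ` {..<(\<Sum>S\<in>\<S>. \<mu> S)} \<union> range Inr"

definition codes :: "('p \<Rightarrow> nat + 'p \<Rightarrow> 'f) set" where
  "codes = UNIV \<rightarrow>\<^sub>E (code_index \<rightarrow>\<^sub>E K)"

definition code_transmission :: "('p \<Rightarrow> nat + 'p \<Rightarrow> 'f) \<Rightarrow> ('v \<Rightarrow> nat \<Rightarrow> 'f) \<Rightarrow> ('p \<Rightarrow> 'f) \<Rightarrow> bool" where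
  "code_transmission c = transmission G \<S> \<mu> (\<lambda>i e. c e (Inl i)) (\<lambda>e' e. c e (Inr e'))"

text \<open>The vector against which the coefficients of an output port of \<open>V\<close> are
  multiplied, with zeros at the processes and ports foreign to \<open>V\<close>.\<close>

definition received :: "('v \<Rightarrow> nat \<Rightarrow> 'f) \<Rightarrow> ('p \<Rightarrow> 'f) \<Rightarrow> 'v \<Rightarrow> nat + 'p \<Rightarrow> 'f" where
  "received x Y V d = (case d of
     Inl i \<Rightarrow> if V \<in> \<S> \<and> i < \<mu> V then x V i else 0
   | Inr e' \<Rightarrow> if e' \<in> inp G V then Y e' else 0)"

lemma finite_code_index [simp]: "finite code_index"
  by (simp add: code_index_def)

lemma finite_codes: "finite codes"
  by (simp add: codes_def finite_PiE)

lemma card_codes_pos: "card codes > 0"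
proof -
  have "codes \<noteq> {}" by (auto simp: codes_def PiE_eq_empty_iff)
  then show ?thesis using finite_codes by (simp add: card_gt_0_iff)
qed

lemma process_index: "\<lbrakk>S \<in> \<S>; i < \<mu> S\<rbrakk> \<Longrightarrow> Inl i \<in> code_index"
  using member_le_sum[of S \<S> \<mu>] finite_sources by (auto simp: code_index_def)

lemma codes_closed: "\<lbrakk>c \<in> codes; d \<in> code_index\<rbrakk> \<Longrightarrow> c e d \<in> K"
  by (auto simp: codes_def PiE_iff)

lemma sum_received:
  "(\<Sum>d\<in>code_index. c e d * received x Y V d) =
     (\<Sum>e'\<in>inp G V. c e (Inr e') * Y e') + (if V \<in> \<S> then \<Sum>i<\<mu> V. c e (Inl i) * x V i else 0)"
proof -
  let ?m = "\<Sum>S\<in>\<S>. \<mu> S"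
  have "(\<Sum>d\<in>code_index. c e d * received x Y V d) =
      (\<Sum>d\<in>Inl ` {..<?m}. c e d * received x Y V d) + (\<Sum>d\<in>range Inr. c e d * received x Y V d)"
    unfolding code_index_def by (rule sum.union_disjoint) auto
  also have "(\<Sum>d\<in>range Inr. c e d * received x Y V d) = (\<Sum>e'\<in>UNIV. if e' \<in> inp G V then c e (Inr e') * Y e' else 0)"
    by (subst sum.reindex) (auto simp: received_def intro!: sum.cong)
  also have "\<dots> = (\<Sum>e'\<in>inp G V. c e (Inr e') * Y e')"
    by (simp add: sum.If_cases)
  also have "(\<Sum>d\<in>Inl ` {..<?m}. c e d * received x Y V d) =
      (\<Sum>i<?m. if V \<in> \<S> \<and> i < \<mu> V then c e (Inl i) * x V i else 0)"
    by (subst sum.reindex) (auto simp: received_def intro!: sum.cong)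
  also have "\<dots> = (if V \<in> \<S> then \<Sum>i<\<mu> V. c e (Inl i) * x V i else 0)"
  proof (cases "V \<in> \<S>")
    case True
    \<comment> \<open>The total rate bounds each single \<open>\<mu> V\<close>, so the common index
      range contains the processes of \<open>V\<close>.\<close>
    then have "{..<?m} \<inter> {i. i < \<mu> V} = {..<\<mu> V}"
      using member_le_sum[of V \<S> \<mu>] finite_sources by auto
    then show ?thesis using True by (simp add: sum.If_cases)
  qed simp
  finally show ?thesis by (simp add: add.commute)
qed

lemma code_transmission_outp:
  assumes "code_transmission c x Y" "V \<in> nodes G" "e \<in> outp G V"
  shows "Y e = (\<Sum>d\<in>code_index. c e d * received x Y V d)"
  using assms unfolding sum_received code_transmission_def transmission_def by blast

lemma code_transmission_closed:
  assumes "c \<in> codes" "code_transmission c x Y" "\<And>S i. x S i \<in> K" "V \<in> nodes G" "e \<in> inp G V \<union> outp G V"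
  shows "Y e \<in> K"
  using assms(2) unfolding code_transmission_def
  by (rule transmission_closed[OF subfield_of_type_axioms])
    (use assms process_index codes_closed in \<open>auto simp: code_index_def\<close>)

text \<open>A source with a nonzero process of its own counts as reached, whatever arrives at its
  ports. With \<open>Y\<close> existentially quantified, a bound on the size of this set covers
  every solution.\<close>

definition codes_reaching :: "('v \<Rightarrow> nat \<Rightarrow> 'f) \<Rightarrow> 'v set \<Rightarrow> ('p \<Rightarrow> nat + 'p \<Rightarrow> 'f) set" where
  "codes_reaching x \<Omega> = {c \<in> codes. \<exists>Y. code_transmission c x Y \<and>
     \<Omega> = {V \<in> nodes G. \<exists>d\<in>code_index. received x Y V d \<noteq> 0}}"

text \<open>
  The signals \<open>y\<close> on the output ports of \<open>\<Omega>\<close> determine all others, and lie in the kernel of the cut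
  matrix. For fixed \<open>y\<close>, each of these ports imposes one nontrivial linear equation on its own
  coefficients.
\<close>

lemma card_codes_reaching_le:
  assumes B: "row_basis_over K (cut_matrix G \<Omega>) B" and \<Omega>: "\<Omega> \<subseteq> nodes G" and x: "\<And>S i. x S i \<in> K"
  shows "card (codes_reaching x \<Omega>) * card K ^ card B \<le> card codes"
proof -
  let ?P = "\<Union>V\<in>\<Omega>. outp G V"
  define owner where "owner e = (THE V. V \<in> nodes G \<and> e \<in> outp G V)" for e
  have owner: "owner e = V" if "V \<in> nodes G" "e \<in> outp G V" for e V
    unfolding owner_def by (rule the_equality) (use that outp_unique in blast)+
  define Ker where "Ker = {y. (\<forall>e\<in>?P. y e \<in> K) \<and> (\<forall>e. e \<notin> ?P \<longrightarrow> y e = 0) \<and>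
    (\<forall>i. (\<Sum>e\<in>UNIV. (cut_matrix G \<Omega> :: 'f ^ 'p ^ 'p) $ i $ e * y e) = 0)}"
  have Ker: "finite Ker" "card Ker * card K ^ card B \<le> card K ^ card ?P"
    using card_kernel_le[OF B, of ?P] cut_matrix_eq_0 unfolding Ker_def by blast+
  \<comment> \<open>What the nodes receive, computed from \<open>y\<close> alone. For a fixed
    \<open>y\<close> it is independent of the code, so the port equations become linear in the
    code.\<close>
  define w where "w y V = received x (\<lambda>e'. \<Sum>e | (e, e') \<in> edges G. y e) V" for y V
  \<comment> \<open>If some node of \<open>\<Omega>\<close> received only zeros, \<open>y\<close>
    could not come from a code reaching exactly \<open>\<Omega>\<close>. Otherwise all the port
    equations are nontrivial.\<close>
  define C where "C y = (if \<forall>V\<in>\<Omega>. \<exists>d\<in>code_index. w y V d \<noteq> 0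
     then {c \<in> codes. \<forall>e\<in>?P. (\<Sum>d\<in>code_index. c e d * w y (owner e) d) = y e} else {})" for y
  have card_C: "card (C y) * card K ^ card ?P \<le> card codes" for y
  proof (cases "\<forall>V\<in>\<Omega>. \<exists>d\<in>code_index. w y V d \<noteq> 0")
    case True
    then have "\<exists>d\<in>code_index. w y (owner e) d \<noteq> 0" if "e \<in> ?P" for e
      using that \<Omega> owner by (metis UN_E subsetD)
    with card_codes_le[of code_index ?P "\<lambda>e. w y (owner e)" y] True show ?thesis
      by (simp add: C_def codes_def)
  qed (auto simp: C_def)
  have finC: "finite (C y)" for y
    by (rule finite_subset[OF _ finite_codes]) (auto simp: C_def)
  have "codes_reaching x \<Omega> \<subseteq> (\<Union>y\<in>Ker. C y)"
  proof
    fix c assume "c \<in> codes_reaching x \<Omega>"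
    then obtain Y where c: "c \<in> codes" and Y: "code_transmission c x Y"
      and active: "\<Omega> = {V \<in> nodes G. \<exists>d\<in>code_index. received x Y V d \<noteq> 0}"
      unfolding codes_reaching_def by blast
    define y where "y e = (if e \<in> ?P then Y e else 0)" for e
    \<comment> \<open>A node that receives only zeros sends only zeros.\<close>
    have silent: "Y e = 0" if "V \<in> nodes G - \<Omega>" "e \<in> outp G V" for V e
    proof -
      have "received x Y V d = 0" if "d \<in> code_index" for d
        using that \<open>V \<in> nodes G - \<Omega>\<close> active by blast
      then show ?thesis using code_transmission_outp[OF Y, of V e] that by simp
    qed
    have Yy: "Y e = y e" if "(e, e') \<in> edges G" for e e'
      using that silent by (cases "e \<in> ?P") (auto simp: y_def elim!: edge_source)
    have inp: "Y e' = (\<Sum>e | (e, e') \<in> edges G. y e)" if "V \<in> nodes G" "e' \<in> inp G V" for V e'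
      using Y that Yy unfolding code_transmission_def transmission_def by simp
    have received: "received x Y V d = w y V d" if "V \<in> nodes G" for V d
      using inp[OF that] by (auto simp: received_def w_def split: sum.split)
    \<comment> \<open>An input port beyond the cut carries zero and gets nothing from the silent
      nodes beyond the cut, so the contribution of \<open>\<Omega>\<close> must cancel to zero. All
      other rows of the matrix are zero.\<close>
    have "(\<Sum>e\<in>UNIV. (cut_matrix G \<Omega> :: 'f ^ 'p ^ 'p) $ e' $ e * y e) = 0" for e'
    proof (cases "e' \<in> (\<Union>V\<in>nodes G - \<Omega>. inp G V)")
      case True
      then obtain V where V: "V \<in> nodes G - \<Omega>" "e' \<in> inp G V" by blast
      have "Inr e' \<in> code_index" by (simp add: code_index_def)
      then have "received x Y V (Inr e') = 0" using V(1) active by blast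
      then have "Y e' = 0" using V(2) by (simp add: received_def)
      moreover have "Y e = 0" if "e \<in> (\<Union>W\<in>nodes G - \<Omega>. outp G W)" for e
        using that silent by blast
      ultimately have "(\<Sum>e\<in>UNIV. (cut_matrix G \<Omega> :: 'f ^ 'p ^ 'p) $ e' $ e * Y e) = 0"
        using transmission_across_cut[OF Y[unfolded code_transmission_def] \<Omega> V] by simp
      moreover have "(cut_matrix G \<Omega> :: 'f ^ 'p ^ 'p) $ e' $ e * Y e = cut_matrix G \<Omega> $ e' $ e * y e" for e
        using cut_matrix_eq_0[of e \<Omega> e', where ?'a = 'f] by (auto simp: y_def)
      ultimately show ?thesis by simp
    next
      case False
      then have "(cut_matrix G \<Omega> :: 'f ^ 'p ^ 'p) $ e' $ e = 0" for e
        by (auto simp: cut_matrix_def)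
      then show ?thesis by simp
    qed
    moreover have "y e \<in> K" if "e \<in> ?P" for e
      using that \<Omega> code_transmission_closed[OF c Y x] unfolding y_def by (metis UN_E UnI2 subsetD)
    ultimately have "y \<in> Ker" by (simp add: Ker_def y_def)
    moreover have "c \<in> C y"
    proof -
      have "\<forall>V\<in>\<Omega>. \<exists>d\<in>code_index. w y V d \<noteq> 0"
      proof
        fix V assume "V \<in> \<Omega>"
        then have "V \<in> nodes G" "\<exists>d\<in>code_index. received x Y V d \<noteq> 0" using active by blast+
        then show "\<exists>d\<in>code_index. w y V d \<noteq> 0" by (simp add: received)
      qed
      moreover have "(\<Sum>d\<in>code_index. c e d * w y (owner e) d) = y e" if "e \<in> ?P" for e
      proof -
        obtain V where V: "V \<in> nodes G" "e \<in> outp G V" using \<open>e \<in> ?P\<close> \<Omega> by blast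
        show ?thesis
          using code_transmission_outp[OF Y V] that by (simp add: owner[OF V] received[OF V(1)] y_def)
      qed
      ultimately have "(\<forall>V\<in>\<Omega>. \<exists>d\<in>code_index. w y V d \<noteq> 0) \<and>
          (\<forall>e\<in>?P. (\<Sum>d\<in>code_index. c e d * w y (owner e) d) = y e)" by blast
      then show ?thesis using c by (simp add: C_def)
    qed
    ultimately show "c \<in> (\<Union>y\<in>Ker. C y)" by blast
  qed
  \<comment> \<open>Each \<open>y\<close> accounts for a fraction of at most |K|^(-|P|) of the
    codes, and the kernel has at most |K|^(|P|-|B|) elements; this leaves |K|^(-|B|).\<close>
  then have "card (codes_reaching x \<Omega>) \<le> card (\<Union>y\<in>Ker. C y)"
    using Ker(1) finC by (intro card_mono) auto
  also have "\<dots> \<le> (\<Sum>y\<in>Ker. card (C y))" by (rule card_UN_le[OF Ker(1)])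
  finally have "card (codes_reaching x \<Omega>) * card K ^ card ?P \<le> (\<Sum>y\<in>Ker. card (C y) * card K ^ card ?P)"
    by (simp flip: sum_distrib_right)
  also have "\<dots> \<le> (\<Sum>y\<in>Ker. card codes)" by (intro sum_mono card_C)
  finally have "card (codes_reaching x \<Omega>) * card K ^ card ?P * card K ^ card B \<le> card Ker * card codes * card K ^ card B"
    by simp
  also have "\<dots> = card Ker * card K ^ card B * card codes" by simp
  also have "\<dots> \<le> card K ^ card ?P * card codes" using Ker(2) by (rule mult_right_mono) simp
  finally have "card K ^ card ?P * (card (codes_reaching x \<Omega>) * card K ^ card B) \<le> card K ^ card ?P * card codes"
    by (simp add: ac_simps)
  moreover have "card K ^ card ?P > 0" using card_K_gt_1 by simp
  ultimately show ?thesis by (simp only: mult_le_cancel1)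
qed

section \<open>Union bound over inputs and reached sets\<close>

definition processes :: "'v set \<Rightarrow> ('v \<times> nat) set" where
  "processes \<Omega> = Sigma (\<S> \<inter> \<Omega>) (\<lambda>S. {..<\<mu> S})"

text \<open>A source outside the reached set has only zero processes, hence the support condition.
  Scaling an input scales all symbols and keeps the reached set, so a nonzero coordinate can be set
  to 1; this saves the factor \<open>card K\<close> by which the union bound succeeds.\<close>

definition normalized_inputs :: "'v set \<Rightarrow> 'v \<times> nat \<Rightarrow> ('v \<times> nat \<Rightarrow> 'f) set" where
  "normalized_inputs \<Omega> j =
     {z. (\<forall>i\<in>processes \<Omega>. z i \<in> K) \<and> (\<forall>i. i \<notin> processes \<Omega> \<longrightarrow> z i = 0) \<and> z j = 1}"

lemma finite_processes [simp]: "finite (processes \<Omega>)"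
  using finite_sources by (simp add: processes_def)

lemma card_processes: "card (processes \<Omega>) = (\<Sum>S\<in>\<S> \<inter> \<Omega>. \<mu> S)"
  using finite_sources by (simp add: processes_def card_SigmaI)

lemma card_codes_reaching_normalized_le:
  assumes B: "row_basis_over K (cut_matrix G \<Omega>) B" "(\<Sum>S\<in>\<S> \<inter> \<Omega>. \<mu> S) \<le> card B"
    and \<Omega>: "\<Omega> \<subseteq> nodes G" and j: "j \<in> processes \<Omega>"
  shows "card (\<Union>z\<in>normalized_inputs \<Omega> j. codes_reaching (curry z) \<Omega>) * card K \<le> card codes"
proof -
  let ?N = "normalized_inputs \<Omega> j" and ?R = "\<lambda>z. codes_reaching (curry z) \<Omega>"
    and ?m = "card (processes \<Omega>)"
  have N: "finite ?N" "card ?N * card K \<le> card K ^ ?m"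
    using card_normalized_le[OF finite_processes j] by (simp_all add: normalized_inputs_def)
  have R: "card (?R z) * card K ^ ?m \<le> card codes" if "z \<in> ?N" for z
  proof -
    have "curry z S i \<in> K" for S i
      using that by (cases "(S, i) \<in> processes \<Omega>") (auto simp: normalized_inputs_def)
    then have "card (?R z) * card K ^ card B \<le> card codes"
      by (rule card_codes_reaching_le[OF B(1) \<Omega>])
    moreover have "card K ^ ?m \<le> card K ^ card B"
      using B(2) card_K_gt_1 by (intro power_increasing) (auto simp: card_processes)
    ultimately show ?thesis by (meson le_trans mult_le_mono2)
  qed
  have "card (\<Union>z\<in>?N. ?R z) \<le> (\<Sum>z\<in>?N. card (?R z))" by (rule card_UN_le[OF N(1)])
  then have "card (\<Union>z\<in>?N. ?R z) * card K ^ ?m \<le> (\<Sum>z\<in>?N. card (?R z) * card K ^ ?m)"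
    by (simp flip: sum_distrib_right)
  also have "\<dots> \<le> (\<Sum>z\<in>?N. card codes)" by (intro sum_mono R)
  finally have "card (\<Union>z\<in>?N. ?R z) * card K ^ ?m * card K \<le> card ?N * card codes * card K" by simp
  also have "\<dots> = card ?N * card K * card codes" by simp
  also have "\<dots> \<le> card K ^ ?m * card codes" using N(2) by (rule mult_right_mono) simp
  finally have "card K ^ ?m * (card (\<Union>z\<in>?N. ?R z) * card K) \<le> card K ^ ?m * card codes"
    by (simp add: ac_simps)
  moreover have "card K ^ ?m > 0" using card_K_gt_1 by simp
  ultimately show ?thesis by (simp only: mult_le_cancel1)
qed

text \<open>There are at most \<open>2 ^ card (nodes G)\<close> times the total rate many pairs of a
  reached set and a normalized coordinate. Each excludes at most a fraction
  \<open>1 / card K\<close> of the codes, so some code survives.\<close>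

lemma exists_reliable_code:
  assumes bound: "\<And>T \<Omega>. \<lbrakk>T \<in> \<T>; \<Omega> \<subseteq> nodes G; T \<notin> \<Omega>\<rbrakk> \<Longrightarrow>
      \<exists>B. row_basis_over K (cut_matrix G \<Omega>) B \<and> (\<Sum>S\<in>\<S> \<inter> \<Omega>. \<mu> S) \<le> card B"
    and K: "2 ^ card (nodes G) * (\<Sum>S\<in>\<S>. \<mu> S) < card K"
  shows "\<exists>c\<in>codes. \<forall>T\<in>\<T>. \<forall>\<Omega>\<subseteq>nodes G. T \<notin> \<Omega> \<longrightarrow>
    (\<forall>j\<in>processes \<Omega>. \<forall>z\<in>normalized_inputs \<Omega> j. c \<notin> codes_reaching (curry z) \<Omega>)"
proof -
  define J where "J = {(\<Omega>, j). \<Omega> \<subseteq> nodes G \<and> \<not> \<T> \<subseteq> \<Omega> \<and> j \<in> processes \<Omega>}"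
  define bad where "bad = (\<lambda>(\<Omega>, j). \<Union>z\<in>normalized_inputs \<Omega> j. codes_reaching (curry z) \<Omega>)"
  have sub: "J \<subseteq> Pow (nodes G) \<times> processes UNIV" by (auto simp: J_def processes_def)
  have fin: "finite (Pow (nodes G) \<times> processes UNIV)" using finite_nodes by simp
  have finJ: "finite J" by (rule finite_subset[OF sub fin])
  have "bad j \<subseteq> codes" for j by (auto simp: bad_def codes_reaching_def split: prod.split)
  then have fin_bad: "finite (\<Union>j\<in>J. bad j)" using finite_codes by (meson UN_least finite_subset)
  have "card J \<le> 2 ^ card (nodes G) * (\<Sum>S\<in>\<S>. \<mu> S)"
    using card_mono[OF fin sub] finite_nodes by (simp add: card_cartesian_product card_Pow card_processes)
  then have J: "card J < card K" using K by simp
  have "card (bad j) * card K \<le> card codes" if "j \<in> J" for j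
  proof -
    from that obtain \<Omega> i T where j: "j = (\<Omega>, i)" "\<Omega> \<subseteq> nodes G" "i \<in> processes \<Omega>" "T \<in> \<T>" "T \<notin> \<Omega>"
      by (auto simp: J_def)
    from bound[OF j(4,2,5)] obtain B where "row_basis_over K (cut_matrix G \<Omega>) B"
      "(\<Sum>S\<in>\<S> \<inter> \<Omega>. \<mu> S) \<le> card B" by (elim exE conjE)
    from card_codes_reaching_normalized_le[OF this j(2,3)] show ?thesis by (simp add: bad_def j(1))
  qed
  then have "(\<Sum>j\<in>J. card (bad j) * card K) \<le> (\<Sum>j\<in>J. card codes)" by (rule sum_mono)
  moreover have "card (\<Union>j\<in>J. bad j) \<le> (\<Sum>j\<in>J. card (bad j))" by (rule card_UN_le[OF finJ])
  then have "card (\<Union>j\<in>J. bad j) * card K \<le> (\<Sum>j\<in>J. card (bad j) * card K)"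
    by (simp flip: sum_distrib_right)
  ultimately have "card (\<Union>j\<in>J. bad j) * card K \<le> card J * card codes" by simp
  also have "\<dots> < card K * card codes" using J card_codes_pos by simp
  finally have "card (\<Union>j\<in>J. bad j) < card codes" by (simp add: mult.commute)
  then have "\<not> codes \<subseteq> (\<Union>j\<in>J. bad j)"
    using card_mono[of "\<Union>j\<in>J. bad j" codes] fin_bad by auto
  then obtain c where "c \<in> codes" "c \<notin> (\<Union>j\<in>J. bad j)" by blast
  then show ?thesis by (intro bexI[of _ c]) (auto simp: J_def bad_def)
qed

text \<open>For a reliable code no nonzero input is invisible at a destination. The responses to the
  unit inputs are therefore independent on its input ports, and dual functionals serve as
  decoders.\<close>

lemma rate_le_imp_solvable_over:
  assumes T_nodes: "\<T> \<subseteq> nodes G" and disj: "\<S> \<inter> \<T> = {}"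
    and bound: "\<And>T \<Omega>. \<lbrakk>T \<in> \<T>; \<Omega> \<subseteq> nodes G; T \<notin> \<Omega>\<rbrakk> \<Longrightarrow>
      \<exists>B. row_basis_over K (cut_matrix G \<Omega>) B \<and> (\<Sum>S\<in>\<S> \<inter> \<Omega>. \<mu> S) \<le> card B"
    and K: "2 ^ card (nodes G) * (\<Sum>S\<in>\<S>. \<mu> S) < card K"
  shows "solvable_over K G \<S> \<mu> (multicast_connections \<S> \<T> \<mu>)"
proof -
  have "\<exists>c\<in>codes. \<forall>T\<in>\<T>. \<forall>\<Omega>\<subseteq>nodes G. T \<notin> \<Omega> \<longrightarrow>
      (\<forall>j\<in>processes \<Omega>. \<forall>z\<in>normalized_inputs \<Omega> j. c \<notin> codes_reaching (curry z) \<Omega>)"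
    by (rule exists_reliable_code[OF _ K]) (rule bound)
  then obtain c where c: "c \<in> codes"
    and good: "\<forall>T\<in>\<T>. \<forall>\<Omega>\<subseteq>nodes G. T \<notin> \<Omega> \<longrightarrow>
      (\<forall>j\<in>processes \<Omega>. \<forall>z\<in>normalized_inputs \<Omega> j. c \<notin> codes_reaching (curry z) \<Omega>)"
    by (elim bexE)
  let ?I = "processes UNIV"
  define unit_input :: "'v \<times> nat \<Rightarrow> 'v \<Rightarrow> nat \<Rightarrow> 'f" where
    "unit_input j S i = (if (S, i) = j then 1 else 0)" for j S i
  have "\<forall>j. \<exists>Y. code_transmission c (unit_input j) Y"
    unfolding code_transmission_def using transmission_exists by blast
  from choice[OF this] obtain U where U: "\<And>j. code_transmission c (unit_input j) (U j)" by blast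
  have UK: "U j e \<in> K" if "V \<in> nodes G" "e \<in> inp G V" for j V e
    by (rule code_transmission_closed[OF c U _ that(1)]) (use that(2) in \<open>auto simp: unit_input_def\<close>)
  define Y where "Y x e = (\<Sum>j\<in>?I. case_prod x j * U j e)" for x e
  have Y: "code_transmission c x (Y x)" for x
  proof -
    have "code_transmission c (\<lambda>S i. \<Sum>j\<in>?I. case_prod x j * unit_input j S i) (Y x)"
      unfolding code_transmission_def Y_def
      by (rule transmission_sum) (use U in \<open>simp_all add: code_transmission_def\<close>)
    then show ?thesis
      unfolding code_transmission_def
    proof (rule transmission_cong)
      fix S i assume "S \<in> \<S>" "i < \<mu> S"
      then have "(S, i) \<in> ?I" by (simp add: processes_def)
      moreover have "(\<Sum>j\<in>?I. case_prod x j * unit_input j S i) = (\<Sum>j\<in>?I. if j = (S, i) then x S i else 0)"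
        by (intro sum.cong) (auto simp: unit_input_def)
      ultimately show "(\<Sum>j\<in>?I. case_prod x j * unit_input j S i) = x S i" by simp
    qed simp
  qed
  have reach: "\<exists>e\<in>inp G T. Y x e \<noteq> 0"
    if T: "T \<in> \<T>" and xK: "\<And>S i. x S i \<in> K" and j: "(S0, i0) \<in> ?I" "x S0 i0 \<noteq> 0" for T x S0 i0
  proof (rule ccontr)
    assume "\<not> ?thesis"
    then have silent: "Y x e = 0" if "e \<in> inp G T" for e using that by blast
    \<comment> \<open>The invisible input scaled to have entry 1 at \<open>(S0, i0)\<close>, and set
      to zero outside the actual processes.\<close>
    define z where "z j = (if j \<in> ?I then case_prod x j / x S0 i0 else 0)" for j
    have "Y (curry z) e = Y x e / x S0 i0" for e
      by (auto simp: Y_def z_def curry_def sum_divide_distrib intro!: sum.cong)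
    with silent have silent': "Y (curry z) e = 0" if "e \<in> inp G T" for e using that by simp
    define \<Omega> where "\<Omega> = {V \<in> nodes G. \<exists>d\<in>code_index. received (curry z) (Y (curry z)) V d \<noteq> 0}"
    \<comment> \<open>Since \<open>T\<close> is not a source, it receives nothing but the symbols at
      its input ports.\<close>
    have "received (curry z) (Y (curry z)) T d = 0" for d
      using T disj silent' by (auto simp: received_def split: sum.split)
    then have "T \<notin> \<Omega>" by (simp add: \<Omega>_def)
    have in_\<Omega>: "S \<in> \<Omega>" if "(S, i) \<in> ?I" "z (S, i) \<noteq> 0" for S i
    proof -
      have "S \<in> \<S>" "i < \<mu> S" using that(1) by (auto simp: processes_def)
      then show ?thesis
        using that(2) sources_subset process_index[of S i]
        by (auto simp: \<Omega>_def received_def intro!: bexI[of _ "Inl i"])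
    qed
    have z1: "z (S0, i0) = 1" using j by (simp add: z_def)
    then have j\<Omega>: "(S0, i0) \<in> processes \<Omega>"
      using in_\<Omega>[OF j(1)] j(1) by (simp add: processes_def)
    have "z (S, i) \<in> K" for S i using xK by (simp add: z_def divide_closed)
    moreover have "z (S, i) = 0" if "(S, i) \<notin> processes \<Omega>" for S i
      using that in_\<Omega>[of S i] by (cases "(S, i) \<in> ?I") (auto simp: processes_def z_def)
    ultimately have "z \<in> normalized_inputs \<Omega> (S0, i0)"
      using z1 by (auto simp: normalized_inputs_def)
    moreover have "\<Omega> \<subseteq> nodes G" by (auto simp: \<Omega>_def)
    ultimately have "c \<notin> codes_reaching (curry z) \<Omega>"
      using good T \<open>T \<notin> \<Omega>\<close> j\<Omega> by blast
    moreover have "c \<in> codes_reaching (curry z) \<Omega>"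
      using c Y[of "curry z"] unfolding codes_reaching_def \<Omega>_def by blast
    ultimately show False by blast
  qed
  have dual: "\<exists>\<phi>. (\<forall>j e. \<phi> j e \<in> K) \<and>
     (\<forall>i\<in>?I. \<forall>j\<in>?I. (\<Sum>e\<in>inp G T. \<phi> i e * U j e) = (if i = j then 1 else 0))" if T: "T \<in> \<T>" for T
  proof (rule dual_functionals)
    fix t assume t: "\<And>j. t j \<in> K" "\<And>e. e \<in> inp G T \<Longrightarrow> (\<Sum>j\<in>?I. t j * U j e) = 0"
    show "\<forall>j\<in>?I. t j = 0"
    proof (rule ccontr, clarsimp)
      fix S i assume "(S, i) \<in> ?I" "t (S, i) \<noteq> 0"
      then have "\<exists>e\<in>inp G T. Y (curry t) e \<noteq> 0"
        using t(1) by (intro reach[OF T]) auto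
      then show False using t(2) by (simp add: Y_def)
    qed
  qed (use T T_nodes UK in auto)
  \<comment> \<open>For nodes that are not destinations the functionals default to zero, because all
    coefficients must lie in \<open>K\<close>.\<close>
  have "\<forall>T. \<exists>\<phi>. (\<forall>j e. \<phi> j e \<in> K) \<and> (T \<in> \<T> \<longrightarrow>
     (\<forall>i\<in>?I. \<forall>j\<in>?I. (\<Sum>e\<in>inp G T. \<phi> i e * U j e) = (if i = j then 1 else 0)))"
  proof
    fix T
    show "\<exists>\<phi>. (\<forall>j e. \<phi> j e \<in> K) \<and> (T \<in> \<T> \<longrightarrow>
      (\<forall>i\<in>?I. \<forall>j\<in>?I. (\<Sum>e\<in>inp G T. \<phi> i e * U j e) = (if i = j then 1 else 0)))"
      using dual[of T] by (cases "T \<in> \<T>") (auto intro: exI[of _ "\<lambda>_ _. 0"])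
  qed
  from choice[OF this] obtain \<phi> where \<phi>: "\<And>T j e. \<phi> T j e \<in> K"
    "\<And>T i j. \<lbrakk>T \<in> \<T>; i \<in> ?I; j \<in> ?I\<rbrakk> \<Longrightarrow> (\<Sum>e\<in>inp G T. \<phi> T i e * U j e) = (if i = j then 1 else 0)"
    by blast
  \<comment> \<open>Outputs of a destination are numbered: output \<open>k\<close> reproduces
    process \<open>g k\<close>.\<close>
  obtain g where g: "bij_betw g {..<card ?I} ?I"
    using bij_betw_from_nat_into_finite[OF finite_processes] by blast
  \<comment> \<open>Outside \<open>code_index\<close> the extensional function \<open>c e\<close> is
    \<open>undefined\<close>, which need not lie in \<open>K\<close>; hence the default 0. Every
    \<open>Inr e'\<close> is an index, so \<open>\<beta>\<close> is taken as it stands.\<close>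
  define \<alpha> where "\<alpha> i e = (if Inl i \<in> code_index then c e (Inl i) else 0)" for i e
  define \<beta> where "\<beta> e' e = c e (Inr e')" for e' e
  define \<epsilon> where "\<epsilon> e T k = \<phi> T (g k) e" for e T k
  have decode: "destination_output G \<epsilon> (Y x) T k = case_prod x (g k)" if "T \<in> \<T>" "g k \<in> ?I" for x T k
  proof -
    have "destination_output G \<epsilon> (Y x) T k = (\<Sum>j\<in>?I. case_prod x j * (\<Sum>e\<in>inp G T. \<phi> T (g k) e * U j e))"
      by (simp add: destination_output_def \<epsilon>_def Y_def sum_distrib_left sum.swap[of _ "?I"] ac_simps)
    also have "\<dots> = (\<Sum>j\<in>?I. if j = g k then case_prod x j else 0)"
      using that \<phi>(2) by (intro sum.cong) auto
    finally show ?thesis using that(2) by simp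
  qed
  show ?thesis
    unfolding solvable_over_def
  proof (intro exI conjI allI impI)
    show "\<alpha> i e \<in> K" for i e using c codes_closed by (simp add: \<alpha>_def)
    show "\<beta> e' e \<in> K" for e' e using c codes_closed by (simp add: \<beta>_def code_index_def)
    show "\<epsilon> e T k \<in> K" for e T k by (simp add: \<epsilon>_def \<phi>(1))
    show "transmission G \<S> \<mu> \<alpha> \<beta> x (Y x)" for x
      using Y[of x] unfolding code_transmission_def \<beta>_def
      by (rule transmission_cong) (simp_all add: \<alpha>_def process_index)
    show "\<forall>(S, T, D)\<in>multicast_connections \<S> \<T> \<mu>. \<forall>i\<in>D. \<exists>k<(\<lambda>_. card ?I) T. \<forall>x. (\<forall>S i. x S i \<in> K) \<longrightarrow>
        destination_output G \<epsilon> (Y x) T k = x S i"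
    proof (clarsimp simp: multicast_connections_def)
      fix S T i assume S: "S \<in> \<S>" "T \<in> \<T>" "i < \<mu> S"
      then have "(S, i) \<in> ?I" by (simp add: processes_def)
      then have "(S, i) \<in> g ` {..<card ?I}" using bij_betw_imp_surj_on[OF g] by simp
      then obtain k where k: "k < card ?I" "g k = (S, i)" by auto
      have "destination_output G \<epsilon> (Y x) T k = x S i" for x
        using decode[OF S(2), of k x] k(2) \<open>(S, i) \<in> ?I\<close> by simp
      then show "\<exists>k<card ?I. \<forall>x. (\<forall>S i. x S i \<in> K) \<longrightarrow> destination_output G \<epsilon> (Y x) T k = x S i"
        using k(1) by blast
    qed
  qed
qed

end

section \<open>The cut criterion over finite extensions of the base field\<close>

theorem theorem7:
  fixes G :: "('v, 'p::finite) adt_graph"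
    and \<S> \<T> :: "'v set"
    and \<mu> :: "'v \<Rightarrow> nat"
  assumes "adt_network G"
    and "\<S> \<subseteq> nodes G" and "\<T> \<subseteq> nodes G" and "\<S> \<inter> \<T> = {}"
    and "\<forall>S\<in>\<S>. \<mu> S \<le> card (outp G S)"
  shows "solvable TYPE('q::{field,finite}) G \<S> \<mu> (multicast_connections \<S> \<T> \<mu>) \<longleftrightarrow>
    (\<forall>T\<in>\<T>. \<forall>\<S>'\<subseteq>\<S>. \<forall>\<Omega>. is_cut G \<S>' T \<Omega> \<longrightarrow>
       mincut_maxflow_bound TYPE('q) G \<S>' \<mu> \<Omega>)"
proof -
  have network: "multicast_network G K \<S>" if "finite K" "subfield_of_type K" for K :: "'q alg_closure set"
    by (intro multicast_network.intro finite_subfield_of_type.intro finite_subfield_of_type_axioms.intro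
        multicast_network_axioms.intro assms(1,2) that)
  show ?thesis
  proof (intro iffI ballI allI impI)
    fix T \<S>' \<Omega>
    assume solv: "solvable TYPE('q) G \<S> \<mu> (multicast_connections \<S> \<T> \<mu>)"
      and T: "T \<in> \<T>" "\<S>' \<subseteq> \<S>" "is_cut G \<S>' T \<Omega>"
    from solv obtain K :: "'q alg_closure set" where K: "finite K" "subfield K ring_of_type_algebra"
      "range to_ac \<subseteq> K" "solvable_over K G \<S> \<mu> (multicast_connections \<S> \<T> \<mu>)"
      unfolding solvable_def by blast
    obtain B where B: "card B = cut_value TYPE('q) G \<Omega>"
      "row_basis_over K (cut_matrix G \<Omega>) B"
      using cut_matrix_row_basis[OF K(3)] by blast
    show "mincut_maxflow_bound TYPE('q) G \<S>' \<mu> \<Omega>"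
      using multicast_network.solvable_over_imp_rate_le[OF network[OF K(1) subfield_of_typeI[OF K(2)]] K(4) T B(2)]
      by (simp add: mincut_maxflow_bound_def B(1))
  next
    assume bound: "\<forall>T\<in>\<T>. \<forall>\<S>'\<subseteq>\<S>. \<forall>\<Omega>. is_cut G \<S>' T \<Omega> \<longrightarrow> mincut_maxflow_bound TYPE('q) G \<S>' \<mu> \<Omega>"
    obtain K :: "'q alg_closure set" where K: "finite K"
      "card K > 2 ^ card (nodes G) * (\<Sum>S\<in>\<S>. \<mu> S)" "subfield_of_type K" "range to_ac \<subseteq> K"
      using large_finite_subfield by blast
    have "solvable_over K G \<S> \<mu> (multicast_connections \<S> \<T> \<mu>)"
    proof (rule multicast_network.rate_le_imp_solvable_over[OF network[OF K(1,3)] assms(3,4) _ K(2)])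
      fix T \<Omega> assume T: "T \<in> \<T>" "\<Omega> \<subseteq> nodes G" "T \<notin> \<Omega>"
      obtain B where B: "card B = cut_value TYPE('q) G \<Omega>" "row_basis_over K (cut_matrix G \<Omega>) B"
        using cut_matrix_row_basis[OF K(4)] by blast
      \<comment> \<open>A reached set may contain only some of the sources. It is a cut for exactly
        those, which is where the bound for subsets of \<open>\<S>\<close> enters.\<close>
      have "is_cut G (\<S> \<inter> \<Omega>) T \<Omega>" using T assms(3) by (auto simp: is_cut_def)
      then have "mincut_maxflow_bound TYPE('q) G (\<S> \<inter> \<Omega>) \<mu> \<Omega>" using bound T(1) by blast
      then show "\<exists>B. row_basis_over K (cut_matrix G \<Omega>) B \<and> (\<Sum>S\<in>\<S> \<inter> \<Omega>. \<mu> S) \<le> card B"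
        using B by (auto simp: mincut_maxflow_bound_def)
    qed
    then show "solvable TYPE('q) G \<S> \<mu> (multicast_connections \<S> \<T> \<mu>)"
      unfolding solvable_def using K(1,3,4) subfield_ring_of_typeI by blast
  qed
qed

end
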